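(* Let $A$ be a Lie algebroid, $\omega$ a $2$-form on $A$ (not assumed non-degenerate) and $N$ a $(1,1)$-tensor on $A$ such that $\omega_N=\omega\circ N$ is skew-symmetric. Let $$\mathbf N=\{(x,y)\in\Gamma A\times\Gamma A\mid\omega_Nx=\omega y\},\qquad \mathbf N^+=\{(\omega x,\omega_Nx)\in\Gamma(A^* )\times\Gamma(A^* )\mid x\in\Gamma A\},$$ and let $\mathbf N^*$ be the dual relation of $\mathbf N$. (i) If $(\omega,N)$ is an $\Omega N$-structure, and if $\mathbf N^+=\mathbf N^*$, then $(\mathrm{graph}\,\omega,\mathrm{graph}\,\omega_N)$ is a Dirac pair. (ii) If $(\mathrm{graph}\,\omega,\mathrm{graph}\,\omega_N)$ is a Dirac pair, then $(\omega,N)$ is a weak $\Omega N$-structure.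
   Context: $[~,~]$ denotes the Lie algebroid bracket on $\Gamma A$ and $\mathrm d$ the Lie algebroid differential. A $(1,1)$-tensor is a vector bundle endomorphism $N:A\to A$. A $2$-form $\omega\in\Gamma(\wedge^2A^* )$ is identified with the map $\omega:A\to A^*$, $\omega x=-i_x\omega$, and with the induced map on sections; $\mathrm{graph}\,\omega=\{(x,\omega x)\mid x\in A\}\subset A\oplus A^*$. When $\omega\circ N$ is skew-symmetric (equivalently $\omega\circ N=N^*\circ\omega$), $\omega_N=\omega\circ N$ is regarded as a $2$-form. The Nijenhuis torsion of $N$ is $TN(x_1,x_2)=[Nx_1,Nx_2]-N([Nx_1,x_2]+[x_1,Nx_2])+N^2[x_1,x_2]$; $N$ is a Nijenhuis tensor if $TN=0$. $(\omega,N)$ is an $\Omega N$-structure if $\omega\circ N=N^*\circ\omega$, $N$ is a Nijenhuis tensor, and $\omega$ and $\omega_N$ are closed. $(\omega,N)$ is a weak $\Omega N$-structure if $\omega$ and $\omega_N$ are closed $2$-forms and $\omega(TN(x_1,x_2))=0$ for all $x_1,x_2\in\Gamma A$. A Dirac structure on $A$ is a maximally isotropic subbundle of $A\oplus A^*$ (for the pairing $\langle X+\xi,Y+\eta\rangle=\langle\xi,Y\rangle+\langle\eta,X\rangle$) whose space of sections is closed under the Dorfman bracket $[X+\xi,Y+\eta]=[X,Y]+\mathcal L_X\eta-i_Y(\mathrm d\xi)$. A $2$-form is closed if and only if its graph is a Dirac structure (known fact). The dual of a relation $\mathbf R\subset\Gamma A\times\Gamma A$ is $\mathbf R^*=\{(\beta,\alpha)\in\Gamma(A^*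 )\times\Gamma(A^* )\mid\langle\alpha,u\rangle=\langle\beta,v\rangle\ \forall(u,v)\in\mathbf R\}$. $\mathbf R$ is a Nijenhuis relation if $\langle\alpha,[v_1,v_2]\rangle-\langle\alpha',[v_1,u_2]+[u_1,v_2]\rangle+\langle\alpha'',[u_1,u_2]\rangle=0$ for all $(u_1,v_1),(u_2,v_2)\in\mathbf R$ and all $(\alpha,\alpha'),(\alpha',\alpha'')\in\mathbf R^*$. A Dirac pair is a pair $(L,L')$ of Dirac structures on $A$ such that $\mathbf N_{L,L'}=\{(x,y)\in\Gamma A\times\Gamma A\mid\exists\,\xi\in\Gamma(A^* ),\ (x,\xi)\in\Gamma L',\ (y,\xi)\in\Gamma L\}$ is a Nijenhuis relation. For $L=\mathrm{graph}\,\omega$, $L'=\mathrm{graph}\,\omega_N$ this is the relation $\mathbf N$ of the statement. *)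

theory Defs
  imports "HOL-Analysis.Analysis"
begin

section \<open>Smooth manifolds\<close>

text \<open>
  Model spaces for charts and fibres: finite-dimensional real inner product spaces. In contrast to
  \<^class>\<open>euclidean_space\<close>, dimension 0 is allowed, so that Lie algebras (Lie algebroids
  over a point) and bundles of rank 0 are included.
\<close>

class fin_dim_inner = real_inner +
  assumes finite_spanning_set: "\<exists>B. finite B \<and> (\<forall>x. \<exists>c. x = (\<Sum>b\<in>B. c b *\<^sub>R b))"

instance euclidean_space \<subseteq> fin_dim_inner
proof
  show "\<exists>B::'a set. finite B \<and> (\<forall>x. \<exists>c. x = (\<Sum>b\<in>B. c b *\<^sub>R b))"
    by (metis euclidean_representation finite_Basis)
qed

primrec cn_on :: "nat \<Rightarrow> 'e::real_normed_vector set \<Rightarrow> ('e \<Rightarrow> 'f::real_normed_vector) \<Rightarrow> bool" where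
  "cn_on 0 S f \<longleftrightarrow> continuous_on S f"
| "cn_on (Suc n) S f \<longleftrightarrow> (\<forall>x\<in>S. f differentiable (at x)) \<and>
     (\<forall>v. cn_on n S (\<lambda>x. frechet_derivative f (at x) v))"

text \<open>Only used for open sets \<open>S\<close> in a finite-dimensional space.\<close>

definition smooth_on :: "'e::real_normed_vector set \<Rightarrow> ('e \<Rightarrow> 'f::real_normed_vector) \<Rightarrow> bool" where
  "smooth_on S f \<longleftrightarrow> (\<forall>n. cn_on n S f)"

text \<open>
  A manifold is a Hausdorff, second countable type \<open>'m\<close> with a smooth atlas (not necessarily a
  maximal one). A chart is given by its domain and its coordinate map.
\<close>

type_synonym ('m, 'e) chart = "'m set \<times> ('m \<Rightarrow> 'e)"

definition smooth_atlas ::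
  "('m::{t2_space,second_countable_topology}, 'e::fin_dim_inner) chart set \<Rightarrow> bool" where
  "smooth_atlas C \<longleftrightarrow>
     (\<Union>(U, \<phi>)\<in>C. U) = UNIV \<and>
     (\<forall>(U, \<phi>)\<in>C. open U \<and> open (\<phi> ` U) \<and> homeomorphism U (\<phi> ` U) \<phi> (inv_into U \<phi>)) \<and>
     (\<forall>(U, \<phi>)\<in>C. \<forall>(V, \<psi>)\<in>C. smooth_on (\<phi> ` (U \<inter> V)) (\<psi> \<circ> inv_into U \<phi>))"

text \<open>Smoothness of a vector-valued function on the open set \<open>W\<close> of the manifold.\<close>

definition smooth_fun_on :: "('m, 'e::fin_dim_inner) chart set \<Rightarrow> 'm set \<Rightarrow>
    ('m \<Rightarrow> 'f::real_normed_vector) \<Rightarrow> bool" where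
  "smooth_fun_on C W f \<longleftrightarrow> (\<forall>(U, \<phi>)\<in>C. smooth_on (\<phi> ` (U \<inter> W)) (f \<circ> inv_into U \<phi>))"

text \<open>Tangent vectors at \<open>p\<close> are the derivations at \<open>p\<close> of the algebra of smooth functions.\<close>

definition tangent_vector ::
  "('m, 'e::fin_dim_inner) chart set \<Rightarrow> 'm \<Rightarrow> (('m \<Rightarrow> real) \<Rightarrow> real) \<Rightarrow> bool" where
  "tangent_vector C p D \<longleftrightarrow>
     (\<forall>f g. smooth_fun_on C UNIV f \<longrightarrow> smooth_fun_on C UNIV g \<longrightarrow>
        D (\<lambda>q. f q + g q) = D f + D g \<and>
        D (\<lambda>q. f q * g q) = f p * D g + g p * D f) \<and>
     (\<forall>c f. smooth_fun_on C UNIV f \<longrightarrow> D (\<lambda>q. c * f q) = c * D f)"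

section \<open>Vector bundles and Lie algebroids\<close>

text \<open>
  The total space of a vector bundle \<open>A\<close> over \<open>'m\<close> is presented fibrewise: as a vector space,
  every fibre is identified with \<open>'a\<close>, so that a section is a function \<open>'m \<Rightarrow> 'a\<close>. The
  identifications for different base points are unrelated. Topology and smooth structure come only
  from the local trivialisations \<open>(U, \<tau>)\<close>, where \<open>\<tau> p\<close> is a linear isomorphism from the
  fibre at \<open>p \<in> U\<close> onto the model fibre (again \<open>'a\<close>); as a map to the linear
  automorphisms of \<open>'a\<close>, \<open>\<tau>\<close> need not be continuous. Up to isomorphism every vector bundle of constant rank arises in this way (choose a
  linear isomorphism with the model fibre at each point); the bundle is not assumed to be trivial.

  The component \<open>bracket\<close> is the bracket on sections, and \<open>anchor A p a\<close> is the image of the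
  vector \<open>a\<close> of the fibre over \<open>p\<close> under the anchor, seen as a derivation.
\<close>

record ('m, 'e, 'a) algebroid =
  charts :: "('m, 'e) chart set"
  trivs :: "('m set \<times> ('m \<Rightarrow> 'a \<Rightarrow> 'a)) set"
  bracket :: "('m \<Rightarrow> 'a) \<Rightarrow> ('m \<Rightarrow> 'a) \<Rightarrow> ('m \<Rightarrow> 'a)"
  anchor :: "'m \<Rightarrow> 'a \<Rightarrow> ('m \<Rightarrow> real) \<Rightarrow> real"

definition vector_bundle ::
  "('m::{t2_space,second_countable_topology}, 'e::fin_dim_inner, 'a::fin_dim_inner) algebroid \<Rightarrow> bool"
where
  "vector_bundle A \<longleftrightarrow>
     smooth_atlas (charts A) \<and>
     (\<Union>(U, \<tau>)\<in>trivs A. U) = UNIV \<and>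
     (\<forall>(U, \<tau>)\<in>trivs A. open U \<and> (\<forall>p\<in>U. linear (\<tau> p) \<and> bij (\<tau> p))) \<and>
     (\<forall>(U, \<tau>)\<in>trivs A. \<forall>(V, \<sigma>)\<in>trivs A. \<forall>v.
        smooth_fun_on (charts A) (U \<inter> V) (\<lambda>p. \<sigma> p (inv (\<tau> p) v)))"

definition smooth_functions :: "('m, 'e::fin_dim_inner, 'a) algebroid \<Rightarrow> ('m \<Rightarrow> real) set" where
  "smooth_functions A = {f. smooth_fun_on (charts A) UNIV f}"

text \<open>
  Smoothness of sections of \<open>A\<close>, of the dual bundle, of the bundle of 2-forms and of the
  endomorphism bundle is expressed through their components: \<open>\<lambda>p. inv (\<tau> p) v\<close> is the local
  section of \<open>A\<close> that is constantly \<open>v\<close> in the trivialisation \<open>\<tau>\<close>.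
  Since fibres are finite-dimensional, bounded linear maps between them are just linear maps.
\<close>

definition local_sections ::
  "('m, 'e::fin_dim_inner, 'a::fin_dim_inner) algebroid \<Rightarrow> 'm set \<Rightarrow> ('m \<Rightarrow> 'a) set" where
  "local_sections A W =
     {X. \<forall>(U, \<tau>)\<in>trivs A. smooth_fun_on (charts A) (U \<inter> W) (\<lambda>p. \<tau> p (X p))}"

definition local_dual_sections ::
  "('m, 'e::fin_dim_inner, 'a::fin_dim_inner) algebroid \<Rightarrow> 'm set \<Rightarrow> ('m \<Rightarrow> 'a \<Rightarrow>\<^sub>L real) set" where
  "local_dual_sections A W =
     {\<alpha>. \<forall>(U, \<tau>)\<in>trivs A. \<forall>v.
        smooth_fun_on (charts A) (U \<inter> W) (\<lambda>p. blinfun_apply (\<alpha> p) (inv (\<tau> p) v))}"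

abbreviation "sections A \<equiv> local_sections A UNIV"
abbreviation "dual_sections A \<equiv> local_dual_sections A UNIV"

definition endomorphism ::
  "('m, 'e::fin_dim_inner, 'a::fin_dim_inner) algebroid \<Rightarrow> ('m \<Rightarrow> 'a \<Rightarrow>\<^sub>L 'a) \<Rightarrow> bool" where
  "endomorphism A N \<longleftrightarrow> (\<forall>(U, \<tau>)\<in>trivs A. \<forall>v.
     smooth_fun_on (charts A) U (\<lambda>p. \<tau> p (blinfun_apply (N p) (inv (\<tau> p) v))))"

text \<open>A 2-form is given by its values \<open>\<omega>(x, y) = \<omega> p x y\<close> on each fibre.\<close>

definition two_form ::
  "('m, 'e::fin_dim_inner, 'a::fin_dim_inner) algebroid \<Rightarrow> ('m \<Rightarrow> 'a \<Rightarrow>\<^sub>L 'a \<Rightarrow>\<^sub>L real) \<Rightarrow> bool" where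
  "two_form A \<omega> \<longleftrightarrow>
     (\<forall>p x. blinfun_apply (blinfun_apply (\<omega> p) x) x = 0) \<and>
     (\<forall>(U, \<tau>)\<in>trivs A. \<forall>v w. smooth_fun_on (charts A) U
        (\<lambda>p. blinfun_apply (blinfun_apply (\<omega> p) (inv (\<tau> p) v)) (inv (\<tau> p) w)))"

text \<open>The map on sections induced by a fibrewise linear map.\<close>

definition act :: "('m \<Rightarrow> 'a::real_normed_vector \<Rightarrow>\<^sub>L 'b::real_normed_vector) \<Rightarrow> ('m \<Rightarrow> 'a) \<Rightarrow> ('m \<Rightarrow> 'b)"
where
  "act T X = (\<lambda>p. blinfun_apply (T p) (X p))"

text \<open>The derivative \<open>\<rho>(X)f\<close>.\<close>

definition anchor_deriv ::
  "('m, 'e, 'a) algebroid \<Rightarrow> ('m \<Rightarrow> 'a) \<Rightarrow> ('m \<Rightarrow> real) \<Rightarrow> ('m \<Rightarrow> real)" where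
  "anchor_deriv A X f = (\<lambda>p. anchor A p (X p) f)"

text \<open>
  The anchor is a smooth bundle map to the tangent bundle: it is linear on fibres, and it takes
  smooth sections to smooth vector fields. That it preserves brackets follows from the axioms.
\<close>

definition anchor_map ::
  "('m::{t2_space,second_countable_topology}, 'e::fin_dim_inner, 'a::fin_dim_inner) algebroid \<Rightarrow> bool"
where
  "anchor_map A \<longleftrightarrow>
     (\<forall>p a. tangent_vector (charts A) p (anchor A p a)) \<and>
     (\<forall>p. \<forall>f\<in>smooth_functions A. linear (\<lambda>a. anchor A p a f)) \<and>
     (\<forall>X\<in>sections A. \<forall>f\<in>smooth_functions A. anchor_deriv A X f \<in> smooth_functions A)"

definition lie_algebroid ::
  "('m::{t2_space,second_countable_topology}, 'e::fin_dim_inner, 'a::fin_dim_inner) algebroid \<Rightarrow> bool"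
where
  "lie_algebroid A \<longleftrightarrow>
     vector_bundle A \<and> anchor_map A \<and>
     (\<forall>X\<in>sections A. \<forall>Y\<in>sections A. bracket A X Y \<in> sections A) \<and>
     (\<forall>X\<in>sections A. \<forall>Y\<in>sections A. \<forall>Z\<in>sections A. \<forall>c.
        bracket A (\<lambda>p. c *\<^sub>R X p + Y p) Z = (\<lambda>p. c *\<^sub>R bracket A X Z p + bracket A Y Z p)) \<and>
     (\<forall>X\<in>sections A. \<forall>Y\<in>sections A. bracket A X Y = (\<lambda>p. - bracket A Y X p)) \<and>
     (\<forall>X\<in>sections A. \<forall>Y\<in>sections A. \<forall>Z\<in>sections A.
        (\<lambda>p. bracket A X (bracket A Y Z) p + bracket A Y (bracket A Z X) p
           + bracket A Z (bracket A X Y) p) = (\<lambda>p. 0)) \<and>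
     (\<forall>X\<in>sections A. \<forall>Y\<in>sections A. \<forall>f\<in>smooth_functions A.
        bracket A X (\<lambda>p. f p *\<^sub>R Y p) =
          (\<lambda>p. f p *\<^sub>R bracket A X Y p + anchor_deriv A X f p *\<^sub>R Y p))"

section \<open>Differential calculus of a Lie algebroid\<close>

definition pairing :: "('m \<Rightarrow> 'a::real_normed_vector \<Rightarrow>\<^sub>L real) \<Rightarrow> ('m \<Rightarrow> 'a) \<Rightarrow> ('m \<Rightarrow> real)" where
  "pairing \<alpha> X = (\<lambda>p. blinfun_apply (\<alpha> p) (X p))"

definition eval2 ::
  "('m \<Rightarrow> 'a::real_normed_vector \<Rightarrow>\<^sub>L 'a \<Rightarrow>\<^sub>L real) \<Rightarrow> ('m \<Rightarrow> 'a) \<Rightarrow> ('m \<Rightarrow> 'a) \<Rightarrow> ('m \<Rightarrow> real)" where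
  "eval2 \<omega> X Y = (\<lambda>p. blinfun_apply (blinfun_apply (\<omega> p) (X p)) (Y p))"

text \<open>Values of the differential of a 1-form and of a 2-form on sections.\<close>

definition diff1 :: "('m, 'e, 'a::fin_dim_inner) algebroid \<Rightarrow> ('m \<Rightarrow> 'a \<Rightarrow>\<^sub>L real) \<Rightarrow>
    ('m \<Rightarrow> 'a) \<Rightarrow> ('m \<Rightarrow> 'a) \<Rightarrow> ('m \<Rightarrow> real)" where
  "diff1 A \<xi> X Y = (\<lambda>p.
     anchor_deriv A X (pairing \<xi> Y) p - anchor_deriv A Y (pairing \<xi> X) p
     - pairing \<xi> (bracket A X Y) p)"

definition diff2 :: "('m, 'e, 'a::fin_dim_inner) algebroid \<Rightarrow> ('m \<Rightarrow> 'a \<Rightarrow>\<^sub>L 'a \<Rightarrow>\<^sub>L real) \<Rightarrow>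
    ('m \<Rightarrow> 'a) \<Rightarrow> ('m \<Rightarrow> 'a) \<Rightarrow> ('m \<Rightarrow> 'a) \<Rightarrow> ('m \<Rightarrow> real)" where
  "diff2 A \<omega> X Y Z = (\<lambda>p.
     anchor_deriv A X (eval2 \<omega> Y Z) p - anchor_deriv A Y (eval2 \<omega> X Z) p
     + anchor_deriv A Z (eval2 \<omega> X Y) p
     - eval2 \<omega> (bracket A X Y) Z p + eval2 \<omega> (bracket A X Z) Y p
     - eval2 \<omega> (bracket A Y Z) X p)"

definition closed_two_form ::
  "('m, 'e::fin_dim_inner, 'a::fin_dim_inner) algebroid \<Rightarrow> ('m \<Rightarrow> 'a \<Rightarrow>\<^sub>L 'a \<Rightarrow>\<^sub>L real) \<Rightarrow> bool" where
  "closed_two_form A \<omega> \<longleftrightarrow> two_form A \<omega> \<and>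
     (\<forall>X\<in>sections A. \<forall>Y\<in>sections A. \<forall>Z\<in>sections A. diff2 A \<omega> X Y Z = (\<lambda>p. 0))"

text \<open>
  A map \<open>F\<close> from sections to functions that is linear over the smooth functions is given by a
  unique section of the dual bundle; \<open>one_form_of A F\<close> is this section.
\<close>

definition one_form_of :: "('m, 'e::fin_dim_inner, 'a::fin_dim_inner) algebroid \<Rightarrow>
    (('m \<Rightarrow> 'a) \<Rightarrow> ('m \<Rightarrow> real)) \<Rightarrow> ('m \<Rightarrow> 'a \<Rightarrow>\<^sub>L real)" where
  "one_form_of A F = (THE \<zeta>. \<zeta> \<in> dual_sections A \<and> (\<forall>Z\<in>sections A. pairing \<zeta> Z = F Z))"

text \<open>The Lie derivative \<open>L\<^sub>X \<eta>\<close> and the contraction \<open>i\<^sub>Y (d \<xi>)\<close>.\<close>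

definition lie_derivative :: "('m, 'e::fin_dim_inner, 'a::fin_dim_inner) algebroid \<Rightarrow>
    ('m \<Rightarrow> 'a) \<Rightarrow> ('m \<Rightarrow> 'a \<Rightarrow>\<^sub>L real) \<Rightarrow> ('m \<Rightarrow> 'a \<Rightarrow>\<^sub>L real)" where
  "lie_derivative A X \<eta> = one_form_of A
     (\<lambda>Z p. anchor_deriv A X (pairing \<eta> Z) p - pairing \<eta> (bracket A X Z) p)"

definition contract_diff :: "('m, 'e::fin_dim_inner, 'a::fin_dim_inner) algebroid \<Rightarrow>
    ('m \<Rightarrow> 'a) \<Rightarrow> ('m \<Rightarrow> 'a \<Rightarrow>\<^sub>L real) \<Rightarrow> ('m \<Rightarrow> 'a \<Rightarrow>\<^sub>L real)" where
  "contract_diff A Y \<xi> = one_form_of A (\<lambda>Z. diff1 A \<xi> Y Z)"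

definition dorfman :: "('m, 'e::fin_dim_inner, 'a::fin_dim_inner) algebroid \<Rightarrow>
    ('m \<Rightarrow> 'a) \<times> ('m \<Rightarrow> 'a \<Rightarrow>\<^sub>L real) \<Rightarrow> ('m \<Rightarrow> 'a) \<times> ('m \<Rightarrow> 'a \<Rightarrow>\<^sub>L real) \<Rightarrow>
    ('m \<Rightarrow> 'a) \<times> ('m \<Rightarrow> 'a \<Rightarrow>\<^sub>L real)" where
  "dorfman A = (\<lambda>(X, \<xi>) (Y, \<eta>).
     (bracket A X Y, \<lambda>p. lie_derivative A X \<eta> p - contract_diff A Y \<xi> p))"

section \<open>Nijenhuis tensors and \<open>\<Omega>N\<close>-structures\<close>

definition torsion :: "('m, 'e, 'a::fin_dim_inner) algebroid \<Rightarrow> ('m \<Rightarrow> 'a \<Rightarrow>\<^sub>L 'a) \<Rightarrow>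
    ('m \<Rightarrow> 'a) \<Rightarrow> ('m \<Rightarrow> 'a) \<Rightarrow> ('m \<Rightarrow> 'a)" where
  "torsion A N X Y = (\<lambda>p.
     bracket A (act N X) (act N Y) p
     - act N (\<lambda>q. bracket A (act N X) Y q + bracket A X (act N Y) q) p
     + act N (act N (bracket A X Y)) p)"

definition nijenhuis_tensor ::
  "('m, 'e::fin_dim_inner, 'a::fin_dim_inner) algebroid \<Rightarrow> ('m \<Rightarrow> 'a \<Rightarrow>\<^sub>L 'a) \<Rightarrow> bool" where
  "nijenhuis_tensor A N \<longleftrightarrow> endomorphism A N \<and>
     (\<forall>X\<in>sections A. \<forall>Y\<in>sections A. torsion A N X Y = (\<lambda>p. 0))"

text \<open>
  The map \<open>\<omega> : A \<rightarrow> A*\<close> with \<open>\<omega> x = - i\<^sub>x \<omega>\<close> is \<open>flat \<omega>\<close>. The 2-form whose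
  associated map is \<open>\<omega> \<circ> N\<close> then has the values \<open>\<omega>(N x, y)\<close>; it is \<open>form_comp \<omega> N\<close>.
\<close>

definition flat ::
  "('m \<Rightarrow> 'a::real_normed_vector \<Rightarrow>\<^sub>L 'a \<Rightarrow>\<^sub>L real) \<Rightarrow> ('m \<Rightarrow> 'a \<Rightarrow>\<^sub>L 'a \<Rightarrow>\<^sub>L real)" where
  "flat \<omega> = (\<lambda>p. - \<omega> p)"

definition form_comp :: "('m \<Rightarrow> 'a::real_normed_vector \<Rightarrow>\<^sub>L 'a \<Rightarrow>\<^sub>L real) \<Rightarrow> ('m \<Rightarrow> 'a \<Rightarrow>\<^sub>L 'a) \<Rightarrow>
    ('m \<Rightarrow> 'a \<Rightarrow>\<^sub>L 'a \<Rightarrow>\<^sub>L real)" where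
  "form_comp \<omega> N = (\<lambda>p. \<omega> p o\<^sub>L N p)"

definition skew_symmetric :: "('m \<Rightarrow> 'a::real_normed_vector \<Rightarrow>\<^sub>L 'a \<Rightarrow>\<^sub>L real) \<Rightarrow> bool" where
  "skew_symmetric T \<longleftrightarrow>
     (\<forall>p x y. blinfun_apply (blinfun_apply (T p) x) y = - blinfun_apply (blinfun_apply (T p) y) x)"

text \<open>\<open>\<omega> \<circ> N = N* \<circ> \<omega>\<close>, written out on vectors.\<close>

definition compatible ::
  "('m \<Rightarrow> 'a::real_normed_vector \<Rightarrow>\<^sub>L 'a \<Rightarrow>\<^sub>L real) \<Rightarrow> ('m \<Rightarrow> 'a \<Rightarrow>\<^sub>L 'a) \<Rightarrow> bool" where
  "compatible \<omega> N \<longleftrightarrow>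
     (\<forall>p x y. blinfun_apply (blinfun_apply (flat \<omega> p) (blinfun_apply (N p) x)) y
            = blinfun_apply (blinfun_apply (flat \<omega> p) x) (blinfun_apply (N p) y))"

definition omega_N_structure :: "('m, 'e::fin_dim_inner, 'a::fin_dim_inner) algebroid \<Rightarrow>
    ('m \<Rightarrow> 'a \<Rightarrow>\<^sub>L 'a \<Rightarrow>\<^sub>L real) \<Rightarrow> ('m \<Rightarrow> 'a \<Rightarrow>\<^sub>L 'a) \<Rightarrow> bool" where
  "omega_N_structure A \<omega> N \<longleftrightarrow>
     compatible \<omega> N \<and> nijenhuis_tensor A N \<and>
     closed_two_form A \<omega> \<and> closed_two_form A (form_comp \<omega> N)"

definition weak_omega_N_structure :: "('m, 'e::fin_dim_inner, 'a::fin_dim_inner) algebroid \<Rightarrow>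
    ('m \<Rightarrow> 'a \<Rightarrow>\<^sub>L 'a \<Rightarrow>\<^sub>L real) \<Rightarrow> ('m \<Rightarrow> 'a \<Rightarrow>\<^sub>L 'a) \<Rightarrow> bool" where
  "weak_omega_N_structure A \<omega> N \<longleftrightarrow>
     endomorphism A N \<and> closed_two_form A \<omega> \<and> closed_two_form A (form_comp \<omega> N) \<and>
     (\<forall>X\<in>sections A. \<forall>Y\<in>sections A. act (flat \<omega>) (torsion A N X Y) = (\<lambda>p. 0))"

section \<open>Dirac structures\<close>

text \<open>
  A subset of \<open>A \<oplus> A*\<close> is given by its fibres. Note that \<open>'a \<times> ('a \<Rightarrow>\<^sub>L real)\<close> is
  the fibre of \<open>A \<oplus> A*\<close>, and \<^const>\<open>subspace\<close>, \<^const>\<open>independent\<close> and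
  \<^const>\<open>span\<close> are used for this real vector space.
\<close>

definition sections_of :: "('m, 'e::fin_dim_inner, 'a::fin_dim_inner) algebroid \<Rightarrow>
    ('m \<Rightarrow> ('a \<times> ('a \<Rightarrow>\<^sub>L real)) set) \<Rightarrow> (('m \<Rightarrow> 'a) \<times> ('m \<Rightarrow> 'a \<Rightarrow>\<^sub>L real)) set" where
  "sections_of A L =
     {(X, \<xi>). X \<in> sections A \<and> \<xi> \<in> dual_sections A \<and> (\<forall>p. (X p, \<xi> p) \<in> L p)}"

definition subbundle :: "('m::topological_space, 'e::fin_dim_inner, 'a::fin_dim_inner) algebroid \<Rightarrow>
    ('m \<Rightarrow> ('a \<times> ('a \<Rightarrow>\<^sub>L real)) set) \<Rightarrow> bool" where
  "subbundle A L \<longleftrightarrow>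
     (\<forall>p. subspace (L p)) \<and>
     (\<forall>p. \<exists>W S. open W \<and> p \<in> W \<and> finite S \<and>
        S \<subseteq> local_sections A W \<times> local_dual_sections A W \<and>
        (\<forall>q\<in>W. inj_on (\<lambda>(X, \<xi>). (X q, \<xi> q)) S \<and>
                independent ((\<lambda>(X, \<xi>). (X q, \<xi> q)) ` S) \<and>
                span ((\<lambda>(X, \<xi>). (X q, \<xi> q)) ` S) = L q))"

definition isotropic :: "('a::real_normed_vector \<times> ('a \<Rightarrow>\<^sub>L real)) set \<Rightarrow> bool" where
  "isotropic V \<longleftrightarrow> (\<forall>(x, \<xi>)\<in>V. \<forall>(y, \<eta>)\<in>V. blinfun_apply \<xi> y + blinfun_apply \<eta> x = 0)"

definition maximally_isotropic :: "('a::real_normed_vector \<times> ('a \<Rightarrow>\<^sub>L real)) set \<Rightarrow> bool" where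
  "maximally_isotropic V \<longleftrightarrow> subspace V \<and> isotropic V \<and>
     (\<forall>V'. subspace V' \<and> isotropic V' \<and> V \<subseteq> V' \<longrightarrow> V' = V)"

definition dirac_structure :: "('m::topological_space, 'e::fin_dim_inner, 'a::fin_dim_inner) algebroid \<Rightarrow>
    ('m \<Rightarrow> ('a \<times> ('a \<Rightarrow>\<^sub>L real)) set) \<Rightarrow> bool" where
  "dirac_structure A L \<longleftrightarrow>
     subbundle A L \<and> (\<forall>p. maximally_isotropic (L p)) \<and>
     (\<forall>s\<in>sections_of A L. \<forall>t\<in>sections_of A L. dorfman A s t \<in> sections_of A L)"

definition graph :: "('m \<Rightarrow> 'a::real_normed_vector \<Rightarrow>\<^sub>L 'a \<Rightarrow>\<^sub>L real) \<Rightarrow>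
    ('m \<Rightarrow> ('a \<times> ('a \<Rightarrow>\<^sub>L real)) set)" where
  "graph \<omega> = (\<lambda>p. {(x, blinfun_apply (flat \<omega> p) x) | x. True})"

section \<open>Nijenhuis relations and Dirac pairs\<close>

definition dual_relation :: "('m, 'e::fin_dim_inner, 'a::fin_dim_inner) algebroid \<Rightarrow>
    (('m \<Rightarrow> 'a) \<times> ('m \<Rightarrow> 'a)) set \<Rightarrow> (('m \<Rightarrow> 'a \<Rightarrow>\<^sub>L real) \<times> ('m \<Rightarrow> 'a \<Rightarrow>\<^sub>L real)) set" where
  "dual_relation A R =
     {(\<beta>, \<alpha>). \<beta> \<in> dual_sections A \<and> \<alpha> \<in> dual_sections A \<and>
        (\<forall>(u, v)\<in>R. pairing \<alpha> u = pairing \<beta> v)}"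

definition nijenhuis_relation :: "('m, 'e::fin_dim_inner, 'a::fin_dim_inner) algebroid \<Rightarrow>
    (('m \<Rightarrow> 'a) \<times> ('m \<Rightarrow> 'a)) set \<Rightarrow> bool" where
  "nijenhuis_relation A R \<longleftrightarrow>
     R \<subseteq> sections A \<times> sections A \<and>
     (\<forall>(u\<^sub>1, v\<^sub>1)\<in>R. \<forall>(u\<^sub>2, v\<^sub>2)\<in>R. \<forall>\<alpha> \<alpha>' \<alpha>''.
        (\<alpha>, \<alpha>') \<in> dual_relation A R \<longrightarrow> (\<alpha>', \<alpha>'') \<in> dual_relation A R \<longrightarrow>
        (\<lambda>p. pairing \<alpha> (bracket A v\<^sub>1 v\<^sub>2) p
           - pairing \<alpha>' (\<lambda>q. bracket A v\<^sub>1 u\<^sub>2 q + bracket A u\<^sub>1 v\<^sub>2 q) p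
           + pairing \<alpha>'' (bracket A u\<^sub>1 u\<^sub>2) p) = (\<lambda>p. 0))"

definition relation_of_pair :: "('m, 'e::fin_dim_inner, 'a::fin_dim_inner) algebroid \<Rightarrow>
    ('m \<Rightarrow> ('a \<times> ('a \<Rightarrow>\<^sub>L real)) set) \<Rightarrow> ('m \<Rightarrow> ('a \<times> ('a \<Rightarrow>\<^sub>L real)) set) \<Rightarrow>
    (('m \<Rightarrow> 'a) \<times> ('m \<Rightarrow> 'a)) set" where
  "relation_of_pair A L L' =
     {(x, y). x \<in> sections A \<and> y \<in> sections A \<and>
        (\<exists>\<xi>\<in>dual_sections A. (x, \<xi>) \<in> sections_of A L' \<and> (y, \<xi>) \<in> sections_of A L)}"

definition dirac_pair :: "('m::topological_space, 'e::fin_dim_inner, 'a::fin_dim_inner) algebroid \<Rightarrow>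
    ('m \<Rightarrow> ('a \<times> ('a \<Rightarrow>\<^sub>L real)) set) \<Rightarrow> ('m \<Rightarrow> ('a \<times> ('a \<Rightarrow>\<^sub>L real)) set) \<Rightarrow> bool" where
  "dirac_pair A L L' \<longleftrightarrow>
     dirac_structure A L \<and> dirac_structure A L' \<and> nijenhuis_relation A (relation_of_pair A L L')"

text \<open>The relations \<open>\<^bold>N\<close> and \<open>\<^bold>N\<^sup>+\<close> of a 2-form \<open>\<omega>\<close> and a (1,1)-tensor \<open>N\<close>.\<close>

definition rel_N :: "('m, 'e::fin_dim_inner, 'a::fin_dim_inner) algebroid \<Rightarrow>
    ('m \<Rightarrow> 'a \<Rightarrow>\<^sub>L 'a \<Rightarrow>\<^sub>L real) \<Rightarrow> ('m \<Rightarrow> 'a \<Rightarrow>\<^sub>L 'a) \<Rightarrow> (('m \<Rightarrow> 'a) \<times> ('m \<Rightarrow> 'a)) set" where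
  "rel_N A \<omega> N =
     {(x, y). x \<in> sections A \<and> y \<in> sections A \<and>
        act (flat (form_comp \<omega> N)) x = act (flat \<omega>) y}"

definition rel_N_plus :: "('m, 'e::fin_dim_inner, 'a::fin_dim_inner) algebroid \<Rightarrow>
    ('m \<Rightarrow> 'a \<Rightarrow>\<^sub>L 'a \<Rightarrow>\<^sub>L real) \<Rightarrow> ('m \<Rightarrow> 'a \<Rightarrow>\<^sub>L 'a) \<Rightarrow>
    (('m \<Rightarrow> 'a \<Rightarrow>\<^sub>L real) \<times> ('m \<Rightarrow> 'a \<Rightarrow>\<^sub>L real)) set" where
  "rel_N_plus A \<omega> N = {(act (flat \<omega>) x, act (flat (form_comp \<omega> N)) x) | x. x \<in> sections A}"

end

theory Submission
  imports Defs
begin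

text \<open>
  For a 2-form, closure of the sections of its graph under the Dorfman bracket amounts to closedness:
  the dual component of the bracket of \<open>(X, \<omega> X)\<close> and \<open>(Y, \<omega> Y)\<close> differs from \<open>\<omega> [X, Y]\<close> by
  \<open>d \<omega> (X, Y, \<cdot>)\<close>. The Nijenhuis condition for \<open>\<^bold>N\<close> at a pair of elements of \<open>\<^bold>N\<^sup>+\<close> coming from a section
  \<open>x\<close> reads \<open>\<omega> (x, T) = 0\<close>, where \<open>T\<close> is the torsion with \<open>v\<^sub>i\<close> in place of \<open>N u\<^sub>i\<close>.
  Since always \<open>\<^bold>N\<^sup>+ \<subseteq> \<^bold>N\<^sup>*\<close>, choosing \<open>v\<^sub>i = N u\<^sub>i\<close> gives (ii). For (i), \<open>v\<^sub>i - N u\<^sub>i\<close> is a section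
  of the kernel of \<open>\<omega>\<close>, and such sections preserve \<open>\<omega>\<close> and \<open>\<omega>\<^sub>N\<close>, so they do not contribute.
\<close>

section \<open>Smooth functions on open sets\<close>

text \<open>The obstacle is that \<open>lie_derivative\<close> and \<open>contract_diff\<close> are
  definite descriptions: nothing about the Dorfman bracket can be computed until each is known to
  denote a dual section. Existence requires that a map on sections which is linear over the smooth
  functions depends on its argument only pointwise; uniqueness requires enough global sections to
  separate covectors. Both rest on bump functions, hence on exp (- 1 / t) and on compact balls in
  charts. As model spaces may have dimension 0, a chosen orthonormal basis, possibly empty, serves
  as the standard one. The kernel of \<omega> may change its rank from point to point, so no
  complement or projection is chosen; only global sections \<open>v - N u\<close> of the kernel are
  handled. Bracketing with such a section commutes with \<open>N\<close> only modulo the kernel,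
  which suffices because every identity is read after applying \<omega>.\<close>

lemma cn_on_cong:
  assumes "open S" "\<And>x. x \<in> S \<Longrightarrow> f x = g x" "cn_on n S f"
  shows "cn_on n S g"
  using assms(2,3)
proof (induction n arbitrary: f g)
  case 0
  then show ?case by (metis cn_on.simps(1) continuous_on_cong)
next
  case (Suc n)
  have d: "(g has_derivative frechet_derivative f (at x)) (at x)" if "x \<in> S" for x
  proof -
    have "(f has_derivative frechet_derivative f (at x)) (at x)"
      using Suc.prems(2) that by (simp add: frechet_derivative_works)
    then show ?thesis
      by (rule has_derivative_transform_within_open[OF _ assms(1) that]) (use Suc.prems in auto)
  qed
  have "cn_on n S (\<lambda>x. frechet_derivative g (at x) v)" for v
  proof (rule Suc.IH)
    show "frechet_derivative f (at x) v = frechet_derivative g (at x) v" if "x \<in> S" for x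
      using frechet_derivative_at[OF d[OF that]] by simp
  qed (use Suc.prems in auto)
  then show ?case
    using d by (auto simp: differentiable_def)
qed

text \<open>\<open>cn_on\<close> speaks of the derivative selected by
  \<open>frechet_derivative\<close>; any explicit derivative agrees with it, so the usual
  differentiation rules become introduction rules for smoothness.\<close>

lemma cn_on_SucI:
  assumes "open S" "\<And>x. x \<in> S \<Longrightarrow> (f has_derivative f' x) (at x)"
    and "\<And>v. cn_on n S (\<lambda>x. f' x v)"
  shows "cn_on (Suc n) S f"
proof -
  have "cn_on n S (\<lambda>x. frechet_derivative f (at x) v)" for v
    by (rule cn_on_cong[OF assms(1) _ assms(3)]) (simp add: frechet_derivative_at[OF assms(2), symmetric])
  then show ?thesis
    using assms(2) by (auto simp: differentiable_def)
qed

lemma cn_on_Suc_derivative: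
  "cn_on (Suc n) S f \<Longrightarrow> x \<in> S \<Longrightarrow> (f has_derivative frechet_derivative f (at x)) (at x)"
  by (simp add: frechet_derivative_works)

lemma cn_on_subset: "cn_on n S f \<Longrightarrow> T \<subseteq> S \<Longrightarrow> cn_on n T f"
  by (induction n arbitrary: f) (auto intro: continuous_on_subset)

text \<open>Product and chain rules leave undifferentiated functions next to a derivative, so the
  inductions on the order need the functions themselves at the lower order.\<close>

lemma cn_on_Suc_lower: "cn_on (Suc n) S f \<Longrightarrow> cn_on n S f"
proof (induction n arbitrary: f)
  case 0
  then show ?case
    by (auto intro!: continuous_at_imp_continuous_on differentiable_imp_continuous_within)
next
  case (Suc n)
  then show ?case by (metis cn_on.simps(2))
qed

lemma cn_on_local:
  assumes "\<And>x. x \<in> S \<Longrightarrow> \<exists>T. open T \<and> x \<in> T \<and> cn_on n T f"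
  shows "cn_on n S f"
  using assms
proof (induction n arbitrary: f)
  case 0
  have "isCont f x" if "x \<in> S" for x
    using 0[OF that] by (auto simp: continuous_on_eq_continuous_at)
  then show ?case by (simp add: continuous_at_imp_continuous_on)
next
  case (Suc n)
  have "f differentiable at x" if "x \<in> S" for x
    using Suc.prems[OF that] by auto
  moreover have "cn_on n S (\<lambda>x. frechet_derivative f (at x) v)" for v
    by (rule Suc.IH) (metis Suc.prems cn_on.simps(2))
  ultimately show ?case by simp
qed

lemma cn_on_const: "cn_on n S (\<lambda>x. c)"
  by (induction n arbitrary: c) (auto simp: frechet_derivative_const)

lemma cn_on_bounded_linear:
  assumes "bounded_linear L" "open S" "cn_on n S f"
  shows "cn_on n S (\<lambda>x. L (f x))"
  using assms(3)
proof (induction n arbitrary: f)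
  case 0
  then show ?case by (simp add: bounded_linear.continuous_on[OF assms(1)])
next
  case (Suc n)
  show ?case
    by (rule cn_on_SucI[OF assms(2) bounded_linear.has_derivative[OF assms(1) cn_on_Suc_derivative[OF Suc.prems]]])
      (use Suc in auto)
qed

lemma cn_on_add:
  assumes "open S" "cn_on n S f" "cn_on n S g"
  shows "cn_on n S (\<lambda>x. f x + g x)"
  using assms(2,3)
proof (induction n arbitrary: f g)
  case 0
  then show ?case by (simp add: continuous_on_add)
next
  case (Suc n)
  show ?case
    by (rule cn_on_SucI[OF assms(1) has_derivative_add[OF cn_on_Suc_derivative[OF Suc.prems(1)]
            cn_on_Suc_derivative[OF Suc.prems(2)]]])
      (use Suc in auto)
qed

lemma cn_on_bilinear:
  assumes "bounded_bilinear m" "open S" "cn_on n S f" "cn_on n S g"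
  shows "cn_on n S (\<lambda>x. m (f x) (g x))"
  using assms(3,4)
proof (induction n arbitrary: f g)
  case 0
  then show ?case by (simp add: bounded_bilinear.continuous_on[OF assms(1)])
next
  case (Suc n)
  note lower = Suc.prems[THEN cn_on_Suc_lower]
  show ?case
    by (rule cn_on_SucI[OF assms(2) bounded_bilinear.FDERIV[OF assms(1)
            cn_on_Suc_derivative[OF Suc.prems(1)] cn_on_Suc_derivative[OF Suc.prems(2)]]])
      (use Suc lower in \<open>auto intro!: cn_on_add[OF assms(2)] Suc.IH\<close>)
qed

text \<open>The derivative is, up to sign, a product of the derivative of \<open>f\<close> with two
  copies of the inverse function, which the induction controls at the lower order.\<close>

lemma cn_on_inverse:
  fixes f :: "'e::real_normed_vector \<Rightarrow> real"
  assumes "open S" "cn_on n S f" "\<And>x. x \<in> S \<Longrightarrow> f x \<noteq> 0"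
  shows "cn_on n S (\<lambda>x. inverse (f x))"
  using assms(2)
proof (induction n)
  case 0
  then show ?case using assms(3) by (simp add: continuous_on_inverse)
next
  case (Suc n)
  note IH = Suc.IH[OF cn_on_Suc_lower[OF Suc.prems]]
  show ?case
  proof (rule cn_on_SucI[OF assms(1) Deriv.has_derivative_inverse[OF assms(3) cn_on_Suc_derivative[OF Suc.prems]]])
    fix v
    have "cn_on n S (\<lambda>x. frechet_derivative f (at x) v)"
      using Suc.prems by simp
    then have "cn_on n S (\<lambda>x. inverse (f x) * frechet_derivative f (at x) v * inverse (f x))"
      by (intro cn_on_bilinear[OF bounded_bilinear_mult assms(1)] IH)
    then show "cn_on n S (\<lambda>x. - (inverse (f x) * frechet_derivative f (at x) v * inverse (f x)))"
      by (rule cn_on_bounded_linear[OF bounded_linear_minus[OF bounded_linear_ident] assms(1)])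
  qed
qed

text \<open>
  The functions \<open>exp (- 1 / t) / t ^ k\<close>, extended by 0 to \<open>t \<le> 0\<close>, are a family that is
  closed under derivatives up to linear combinations; so all of them are smooth.
\<close>

definition flat_exp :: "nat \<Rightarrow> real \<Rightarrow> real" where
  "flat_exp k t = (if t > 0 then exp (- inverse t) * inverse t ^ k else 0)"

text \<open>With s = 1 / t the limit from the right is that of s ^ k / exp s at infinity; on the
  left the function is constantly 0.\<close>

lemma flat_exp_tendsto_0: "(flat_exp k \<longlongrightarrow> 0) (at 0)"
proof -
  have "((\<lambda>t. inverse t ^ k / exp (inverse t)) \<longlongrightarrow> 0) (at_right (0::real))"
    by (rule filterlim_compose[OF tendsto_power_div_exp_0 filterlim_inverse_at_top_right])
  then have "(flat_exp k \<longlongrightarrow> 0) (at_right 0)"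
    by (rule Lim_transform_eventually)
      (auto simp: eventually_at_filter flat_exp_def exp_minus field_simps)
  moreover have "(flat_exp k \<longlongrightarrow> 0) (at_left 0)"
    by (rule Lim_transform_eventually[OF tendsto_const]) (auto simp: eventually_at_filter flat_exp_def)
  ultimately show ?thesis
    by (simp add: filterlim_split_at)
qed

text \<open>Differentiating exp (- 1 / t) contributes a factor 1 / t ^ 2 and differentiating 1 / t ^
  k a factor - k / t, whence the shifts of the index by 2 and by 1.\<close>

lemma flat_exp_derivative:
  "(flat_exp k has_real_derivative flat_exp (k + 2) t - real k * flat_exp (k + 1) t) (at t)"
proof (cases t "0::real" rule: linorder_cases)
  case less
  have "((\<lambda>t. 0) has_real_derivative 0) (at t)" by simp
  then have "(flat_exp k has_real_derivative 0) (at t)"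
    by (rule has_field_derivative_transform_within_open[where S = "{..<0}"])
      (use less in \<open>auto simp: flat_exp_def\<close>)
  then show ?thesis using less by (simp add: flat_exp_def)
next
  case equal
  \<comment> \<open>Away from 0 this difference quotient is \<open>flat_exp (k + 1)\<close>, already
    known to tend to 0.\<close>
  have "((\<lambda>h. (flat_exp k (0 + h) - flat_exp k 0) / h) \<longlongrightarrow> 0) (at 0)"
    by (rule Lim_transform_eventually[OF flat_exp_tendsto_0[of "k + 1"]])
      (auto simp: eventually_at_filter flat_exp_def field_simps)
  then show ?thesis using equal by (simp add: DERIV_def flat_exp_def)
next
  case greater
  have "((\<lambda>t. exp (- inverse t)) has_real_derivative exp (- inverse t) * inverse t ^ 2) (at t)"
    using greater by (auto intro!: derivative_eq_intros simp: power2_eq_square)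
  moreover have "((\<lambda>t. inverse t ^ k) has_real_derivative - (real k * inverse t ^ (k + 1))) (at t)"
  \<comment> \<open>The power rule has the exponent \<open>k - 1\<close>, truncated on naturals; for
    \<open>k = 0\<close> the function is constant.\<close>
  proof (cases k)
    case (Suc m)
    have "((\<lambda>t. inverse t ^ k) has_real_derivative real k * inverse t ^ (k - 1) * - (inverse t ^ 2)) (at t)"
      using DERIV_power[OF DERIV_inverse, of t k] greater
      by (simp add: power2_eq_square algebra_simps)
    then show ?thesis using Suc by (simp add: power2_eq_square mult_ac)
  qed simp
  ultimately have "((\<lambda>t. exp (- inverse t) * inverse t ^ k) has_real_derivative
      exp (- inverse t) * inverse t ^ (k + 2) - real k * (exp (- inverse t) * inverse t ^ (k + 1))) (at t)"
    by (rule DERIV_cong[OF DERIV_mult]) (simp add: power2_eq_square algebra_simps)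
  then have "(flat_exp k has_real_derivative
      exp (- inverse t) * inverse t ^ (k + 2) - real k * (exp (- inverse t) * inverse t ^ (k + 1))) (at t)"
    by (rule has_field_derivative_transform_within_open[where S = "{0<..}"])
      (use greater in \<open>auto simp: flat_exp_def\<close>)
  then show ?thesis using greater by (simp add: flat_exp_def)
qed

lemma cn_on_flat_exp:
  assumes "open S" "cn_on n S g"
  shows "cn_on n S (\<lambda>x. flat_exp k (g x))"
  using assms(2)
proof (induction n arbitrary: k)
  case 0
  have "continuous_on UNIV (flat_exp k)"
    using DERIV_isCont[OF flat_exp_derivative] by (simp add: continuous_at_imp_continuous_on)
  then show ?case
    using 0 by (auto intro: continuous_on_compose2)
next
  case (Suc n)
  have "((\<lambda>x. flat_exp k (g x)) has_derivative (\<lambda>v. frechet_derivative g (at x) v *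
      (flat_exp (k + 2) (g x) - real k * flat_exp (k + 1) (g x)))) (at x)" if "x \<in> S" for x
    using has_derivative_compose[OF cn_on_Suc_derivative[OF Suc.prems that]
        flat_exp_derivative[unfolded has_field_derivative_def]]
    by (simp add: mult.commute)
  moreover have "cn_on n S (\<lambda>x. frechet_derivative g (at x) v *
      (flat_exp (k + 2) (g x) + (- real k) * flat_exp (k + 1) (g x)))" for v
    using Suc.prems
    by (intro cn_on_bilinear[OF bounded_bilinear_mult assms(1)] cn_on_add[OF assms(1)] cn_on_const
        Suc.IH cn_on_Suc_lower[OF Suc.prems]) auto
  ultimately show ?case
    by (intro cn_on_SucI[OF assms(1)]) auto
qed

section \<open>Finite-dimensional spaces without a distinguished basis\<close>

lemma ex_orthonormal_basis:
  "\<exists>E::'a::fin_dim_inner set. finite E \<and> pairwise orthogonal E \<and> (\<forall>b\<in>E. norm b = 1) \<and>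
     span E = UNIV"
proof -
  obtain B :: "'a set" where B: "finite B" "\<And>x. \<exists>c. x = (\<Sum>b\<in>B. c b *\<^sub>R b)"
    using finite_spanning_set by blast
  have "span B = UNIV"
    using B(2) by (metis (no_types, lifting) UNIV_eq_I span_base span_scale span_sum)
  obtain C :: "'a set" where C: "finite C" "span C = UNIV" "pairwise orthogonal C"
    using basis_orthogonal[OF B(1)] \<open>span B = UNIV\<close> by auto
  \<comment> \<open>The orthogonal spanning set may contain 0, which cannot be normalised.\<close>
  define E where "E = (\<lambda>x. x /\<^sub>R norm x) ` (C - {0})"
  have "x \<in> span E" if "x \<in> C" for x
  proof (cases "x = 0")
    case False
    then have "x = norm x *\<^sub>R (x /\<^sub>R norm x)" by simp
    moreover have "x /\<^sub>R norm x \<in> E" using that False by (auto simp: E_def)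
    ultimately show ?thesis by (metis span_base span_scale)
  qed (simp add: span_zero)
  then have "span E = UNIV"
    using span_minimal[of C "span E"] C(2) by auto
  moreover have "pairwise orthogonal E"
    using C(3) by (force simp: E_def pairwise_def orthogonal_def)
  ultimately show ?thesis
    using C(1) by (intro exI[of _ E]) (auto simp: E_def)
qed

definition onb :: "'a::fin_dim_inner set" where
  "onb = (SOME E. finite E \<and> pairwise orthogonal E \<and> (\<forall>b\<in>E. norm b = 1) \<and> span E = UNIV)"

lemma onb: "finite (onb :: 'a::fin_dim_inner set)" "pairwise orthogonal (onb :: 'a set)"
  "b \<in> (onb :: 'a set) \<Longrightarrow> norm b = 1" "span (onb :: 'a set) = UNIV"
  using someI_ex[OF ex_orthonormal_basis[where 'a='a]] by (auto simp: onb_def)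

lemma independent_onb: "independent (onb :: 'a::fin_dim_inner set)"
  using onb(2) onb(3)[of 0] by (intro pairwise_orthogonal_independent) auto

text \<open>The difference of both sides is orthogonal to \<open>onb\<close>, hence to its span,
  which is the whole space; so it is orthogonal to itself.\<close>

lemma onb_expansion: "x = (\<Sum>b\<in>onb. (x \<bullet> b) *\<^sub>R b)" for x :: "'a::fin_dim_inner"
proof -
  let ?y = "x - (\<Sum>b\<in>onb. (x \<bullet> b) *\<^sub>R b)"
  have orth: "orthogonal ?y c" if "c \<in> onb" for c
  proof -
    have "c \<bullet> c = 1" using onb(3)[OF that] by (simp add: dot_square_norm)
    then have "(\<Sum>b\<in>onb. (x \<bullet> b) *\<^sub>R b) \<bullet> c = (\<Sum>b\<in>onb. if b = c then x \<bullet> c else 0)"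
      unfolding inner_sum_left
      using that onb(2) by (intro sum.cong) (auto simp: pairwise_def orthogonal_def)
    then show ?thesis
      using that onb(1)[where 'a='a] by (simp add: orthogonal_def inner_diff_left)
  qed
  have "orthogonal ?y ?y"
    by (rule orthogonal_to_span[OF _ orth]) (simp_all add: onb(4))
  then show ?thesis by (simp add: orthogonal_def)
qed

lemma linear_onb:
  fixes f :: "'a::fin_dim_inner \<Rightarrow> 'b::real_vector"
  assumes "linear f"
  shows "f x = (\<Sum>b\<in>onb. (x \<bullet> b) *\<^sub>R f b)"
proof -
  have "f x = f (\<Sum>b\<in>onb. (x \<bullet> b) *\<^sub>R b)"
    by (rule arg_cong[OF onb_expansion])
  then show ?thesis by (simp add: linear_sum[OF assms] linear_scale[OF assms])
qed

text \<open>Serves to turn a functional that is only known to be linear on a fibre into a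
  \<open>blinfun\<close>.\<close>

lemma linear_imp_bounded:
  fixes f :: "'a::fin_dim_inner \<Rightarrow> 'b::real_normed_vector"
  assumes "linear f"
  shows "bounded_linear f"
proof -
  have eq: "f = (\<lambda>x. \<Sum>b\<in>onb. (x \<bullet> b) *\<^sub>R f b)"
    by (rule ext) (rule linear_onb[OF assms])
  show ?thesis
    by (subst eq) (intro bounded_linear_sum bounded_linear_compose[OF bounded_linear_scaleR_left]
      bounded_linear_inner_left)
qed

text \<open>The ball is a closed subset of a box, the set of all combinations of \<open>onb\<close>
  with uniformly bounded coefficients, and boxes are compact by induction on the generating
  set.\<close>

lemma compact_cball_fin_dim: "compact (cball (a::'a::fin_dim_inner) r)"
proof -
  have box: "compact {\<Sum>b\<in>B. c b *\<^sub>R b | c. \<forall>b. \<bar>c b\<bar> \<le> M}"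
    if "finite B" "0 \<le> M" for B :: "'a set" and M :: real
    using that(1)
  proof (induction B)
    case empty
    \<comment> \<open>Here \<open>0 \<le> M\<close> enters: some coefficient function obeying the
      bound has to exist for the set to be nonempty.\<close>
    have "{\<Sum>b\<in>{}. c b *\<^sub>R b | c. \<forall>b::'a. \<bar>c b\<bar> \<le> M} = {0::'a}"
      using that(2) by (auto intro: exI[of _ "\<lambda>_. 0"])
    then show ?case by simp
  next
    case (insert e B)
    let ?K = "{\<Sum>b\<in>B. c b *\<^sub>R b | c. \<forall>b. \<bar>c b\<bar> \<le> M}"
    \<comment> \<open>Splitting off the coefficient of \<open>e\<close> presents the box as a
      continuous image of an interval times the smaller box.\<close>
    have "{\<Sum>b\<in>insert e B. c b *\<^sub>R b | c. \<forall>b. \<bar>c b\<bar> \<le> M} = (\<lambda>(t, x). t *\<^sub>R e + x) ` ({-M..M} \<times> ?K)"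
      (is "?L = ?R")
    proof
      show "?L \<subseteq> ?R"
      proof
        fix x assume "x \<in> ?L"
        then obtain c where c: "\<forall>b. \<bar>c b\<bar> \<le> M" "x = c e *\<^sub>R e + (\<Sum>b\<in>B. c b *\<^sub>R b)"
          using insert.hyps by auto
        moreover have "c e \<in> {-M..M}" using c(1) by (simp add: abs_le_iff minus_le_iff)
        ultimately show "x \<in> ?R" by (auto intro!: image_eqI[of _ _ "(c e, \<Sum>b\<in>B. c b *\<^sub>R b)"])
      qed
      show "?R \<subseteq> ?L"
      proof clarify
        fix t and c :: "'a \<Rightarrow> real" assume "t \<in> {-M..M}" "\<forall>b. \<bar>c b\<bar> \<le> M"
        moreover have "(\<Sum>b\<in>B. (c(e := t)) b *\<^sub>R b) = (\<Sum>b\<in>B. c b *\<^sub>R b)"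
          using insert.hyps(2) by (intro sum.cong) auto
        ultimately show "\<exists>c'. t *\<^sub>R e + (\<Sum>b\<in>B. c b *\<^sub>R b) = (\<Sum>b\<in>insert e B. c' b *\<^sub>R b) \<and>
            (\<forall>b. \<bar>c' b\<bar> \<le> M)"
          using insert.hyps by (intro exI[of _ "c(e := t)"]) auto
      qed
    qed
    moreover have "compact ?R"
      by (rule compact_continuous_image[OF _ compact_Times[OF compact_Icc insert.IH]])
        (auto simp: case_prod_unfold intro!: continuous_intros)
    ultimately show ?case by simp
  qed
  \<comment> \<open>Bounds the norm on the ball and is nonnegative for either sign of
    \<open>r\<close>.\<close>
  define M where "M = norm a + \<bar>r\<bar>"
  have sub: "cball a r \<subseteq> {\<Sum>b\<in>onb. c b *\<^sub>R b | c. \<forall>b. \<bar>c b\<bar> \<le> M}"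
  proof
    fix x assume "x \<in> cball a r"
    then have "norm x \<le> M"
      using norm_triangle_ineq2[of x a] by (simp add: M_def dist_norm norm_minus_commute)
    have "0 \<le> M" by (simp add: M_def)
    have "\<bar>x \<bullet> b\<bar> \<le> M" if "b \<in> onb" for b
      using Cauchy_Schwarz_ineq2[of x b] onb(3)[OF that] \<open>norm x \<le> M\<close> by simp
    \<comment> \<open>The box bounds the coefficient function at every vector, so it is set to 0 off
      the basis.\<close>
    moreover have "(\<Sum>b\<in>onb. (if b \<in> onb then x \<bullet> b else 0) *\<^sub>R b) = x"
      by (rule trans[OF sum.cong onb_expansion[symmetric]]) auto
    ultimately show "x \<in> {\<Sum>b\<in>onb. c b *\<^sub>R b | c. \<forall>b. \<bar>c b\<bar> \<le> M}"
      using \<open>0 \<le> M\<close>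
      by (intro CollectI exI[of _ "\<lambda>b. if b \<in> onb then x \<bullet> b else 0"] conjI) (auto simp del: if_distrib)
  qed
  have comp: "compact {\<Sum>b\<in>onb. c b *\<^sub>R b | c. \<forall>b::'a. \<bar>c b\<bar> \<le> M}"
    by (rule box[OF onb(1)]) (simp add: M_def)
  show ?thesis
    using compact_Int_closed[OF comp closed_cball, of a r] unfolding Int_absorb1[OF sub] .
qed

section \<open>Smooth functions on manifolds\<close>

locale smooth_manifold =
  fixes C :: "('m::{t2_space,second_countable_topology}, 'e::fin_dim_inner) chart set"
  assumes atlas: "smooth_atlas C"
begin

lemma chart_cover: "\<exists>U \<phi>. (U, \<phi>) \<in> C \<and> p \<in> U"
proof -
  have "p \<in> (\<Union>(U, \<phi>)\<in>C. U)"
    using atlas by (simp add: smooth_atlas_def)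
  then show ?thesis by auto
qed

lemma chart:
  assumes "(U, \<phi>) \<in> C"
  shows "open U" "open (\<phi> ` U)" "homeomorphism U (\<phi> ` U) \<phi> (inv_into U \<phi>)"
proof -
  have "\<forall>(U, \<phi>)\<in>C. open U \<and> open (\<phi> ` U) \<and> homeomorphism U (\<phi> ` U) \<phi> (inv_into U \<phi>)"
    using atlas unfolding smooth_atlas_def by (elim conjE)
  from bspec[OF this assms]
  show "open U" "open (\<phi> ` U)" "homeomorphism U (\<phi> ` U) \<phi> (inv_into U \<phi>)" by simp_all
qed

lemma chart_transition:
  assumes "(U, \<phi>) \<in> C" "(V, \<psi>) \<in> C"
  shows "smooth_on (\<phi> ` (U \<inter> V)) (\<psi> \<circ> inv_into U \<phi>)"
proof -
  have "\<forall>(U, \<phi>)\<in>C. \<forall>(V, \<psi>)\<in>C. smooth_on (\<phi> ` (U \<inter> V)) (\<psi> \<circ> inv_into U \<phi>)"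
    using atlas unfolding smooth_atlas_def by (elim conjE)
  from bspec[OF this assms(1)] show ?thesis
    using assms(2) by auto
qed

lemma chart_inv: "(U, \<phi>) \<in> C \<Longrightarrow> q \<in> U \<Longrightarrow> inv_into U \<phi> (\<phi> q) = q"
  using homeomorphism_apply1[OF chart(3)] .

lemma open_chart_image:
  assumes "(U, \<phi>) \<in> C" "open W"
  shows "open (\<phi> ` (U \<inter> W))"
proof -
  have "openin (top_of_set (\<phi> ` U)) (\<phi> ` (U \<inter> W))"
    using chart[OF assms(1)] assms(2)
    by (intro homeomorphism_imp_open_map[OF chart(3)[OF assms(1)]]) (auto simp: openin_open)
  then show ?thesis
    using chart(2)[OF assms(1)] openin_open_trans by blast
qed

lemma smooth_fun_onI:
  "(\<And>U \<phi> n. (U, \<phi>) \<in> C \<Longrightarrow> cn_on n (\<phi> ` (U \<inter> W)) (\<lambda>x. f (inv_into U \<phi> x))) \<Longrightarrow> smooth_fun_on C W f"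
  by (auto simp: smooth_fun_on_def smooth_on_def comp_def)

lemma smooth_fun_onD:
  "smooth_fun_on C W f \<Longrightarrow> (U, \<phi>) \<in> C \<Longrightarrow> cn_on n (\<phi> ` (U \<inter> W)) (\<lambda>x. f (inv_into U \<phi> x))"
  unfolding smooth_fun_on_def by (drule (1) bspec) (simp add: smooth_on_def comp_def)

lemma smooth_fun_on_subset: "smooth_fun_on C W f \<Longrightarrow> V \<subseteq> W \<Longrightarrow> smooth_fun_on C V f"
  by (rule smooth_fun_onI, rule cn_on_subset[OF smooth_fun_onD[of W f]]) auto

lemma smooth_fun_on_cong:
  assumes "open W" "\<And>q. q \<in> W \<Longrightarrow> f q = g q" "smooth_fun_on C W f"
  shows "smooth_fun_on C W g"
  by (rule smooth_fun_onI, rule cn_on_cong[OF open_chart_image[OF _ assms(1)] _ smooth_fun_onD[OF assms(3)]])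
    (auto simp: chart_inv assms(2))

lemma smooth_fun_on_local:
  assumes "\<And>p. p \<in> W \<Longrightarrow> \<exists>V. open V \<and> p \<in> V \<and> smooth_fun_on C V f"
  shows "smooth_fun_on C W f"
proof (intro smooth_fun_onI cn_on_local)
  fix U \<phi> n x assume U: "(U, \<phi>) \<in> C" and "x \<in> \<phi> ` (U \<inter> W)"
  then obtain p where p: "p \<in> U" "p \<in> W" "x = \<phi> p" by auto
  then obtain V where "open V" "p \<in> V" "smooth_fun_on C V f" using assms by blast
  then show "\<exists>T. open T \<and> x \<in> T \<and> cn_on n T (\<lambda>x. f (inv_into U \<phi> x))"
    using open_chart_image[OF U] smooth_fun_onD[OF _ U] p by (intro exI[of _ "\<phi> ` (U \<inter> V)"]) auto
qed

lemma smooth_fun_on_const: "smooth_fun_on C W (\<lambda>q. c)"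
  by (rule smooth_fun_onI) (rule cn_on_const)

lemma smooth_fun_on_bounded_linear:
  "bounded_linear L \<Longrightarrow> open W \<Longrightarrow> smooth_fun_on C W f \<Longrightarrow> smooth_fun_on C W (\<lambda>q. L (f q))"
  by (rule smooth_fun_onI) (rule cn_on_bounded_linear[OF _ open_chart_image smooth_fun_onD])

lemma smooth_fun_on_minus:
  "open W \<Longrightarrow> smooth_fun_on C W f \<Longrightarrow> smooth_fun_on C W (\<lambda>q. - f q)"
  by (rule smooth_fun_on_bounded_linear[OF bounded_linear_minus[OF bounded_linear_ident]])

lemma smooth_fun_on_add:
  "open W \<Longrightarrow> smooth_fun_on C W f \<Longrightarrow> smooth_fun_on C W g \<Longrightarrow> smooth_fun_on C W (\<lambda>q. f q + g q)"
  by (rule smooth_fun_onI, intro cn_on_add smooth_fun_onD open_chart_image)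

lemma smooth_fun_on_diff:
  "open W \<Longrightarrow> smooth_fun_on C W f \<Longrightarrow> smooth_fun_on C W g \<Longrightarrow> smooth_fun_on C W (\<lambda>q. f q - g q)"
  using smooth_fun_on_add[OF _ _ smooth_fun_on_minus, of W f g] by simp

lemma smooth_fun_on_sum:
  assumes "open W" "\<And>i. i \<in> I \<Longrightarrow> smooth_fun_on C W (f i)"
  shows "smooth_fun_on C W (\<lambda>q. \<Sum>i\<in>I. f i q)"
  using assms(2)
  by (induction I rule: infinite_finite_induct) (auto intro: smooth_fun_on_const smooth_fun_on_add assms(1))

lemma smooth_fun_on_scaleR:
  "open W \<Longrightarrow> smooth_fun_on C W f \<Longrightarrow> smooth_fun_on C W g \<Longrightarrow> smooth_fun_on C W (\<lambda>q. f q *\<^sub>R g q)"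
  by (rule smooth_fun_onI, intro cn_on_bilinear[OF bounded_bilinear_scaleR] smooth_fun_onD open_chart_image)

lemma smooth_fun_on_mult:
  fixes f g :: "'m \<Rightarrow> real"
  shows "open W \<Longrightarrow> smooth_fun_on C W f \<Longrightarrow> smooth_fun_on C W g \<Longrightarrow> smooth_fun_on C W (\<lambda>q. f q * g q)"
  using smooth_fun_on_scaleR[of W f g] by simp

lemma smooth_fun_on_inverse:
  fixes f :: "'m \<Rightarrow> real"
  assumes "open W" "smooth_fun_on C W f" "\<And>q. q \<in> W \<Longrightarrow> f q \<noteq> 0"
  shows "smooth_fun_on C W (\<lambda>q. inverse (f q))"
  by (rule smooth_fun_onI, intro cn_on_inverse smooth_fun_onD open_chart_image assms(1,2))
    (auto simp: chart_inv assms(3))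

text \<open>In a chart, \<open>flat_exp 0\<close> is applied to r^2 minus the squared distance from
  the centre. The closed set \<open>K\<close> allows products with local data to be extended by 0;
  the exact description of the nonvanishing set allows division by \<open>f\<close> on it.\<close>

lemma ex_bump_function:
  assumes "open W" "p \<in> W"
  obtains f :: "'m \<Rightarrow> real" and O' K where "smooth_fun_on C UNIV f" "open O'" "closed K"
    "p \<in> O'" "O' \<subseteq> K" "K \<subseteq> W" "\<And>q. f q \<noteq> 0 \<longleftrightarrow> q \<in> O'"
proof -
  obtain U \<phi> where U: "(U, \<phi>) \<in> C" "p \<in> U" using chart_cover by blast
  have "open (\<phi> ` (U \<inter> W))" by (rule open_chart_image[OF U(1) assms(1)])
  moreover have "\<phi> p \<in> \<phi> ` (U \<inter> W)" using U assms by auto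
  ultimately obtain r where r: "r > 0" "cball (\<phi> p) r \<subseteq> \<phi> ` (U \<inter> W)"
    using open_contains_cball by blast
  define K where "K = inv_into U \<phi> ` cball (\<phi> p) r"
  define O' where "O' = U \<inter> \<phi> -` ball (\<phi> p) r"
  define f where "f q = (if q \<in> U then flat_exp 0 (r\<^sup>2 - (\<phi> q - \<phi> p) \<bullet> (\<phi> q - \<phi> p)) else 0)" for q
  have hom: "continuous_on U \<phi>" "continuous_on (\<phi> ` U) (inv_into U \<phi>)"
    using chart(3)[OF U(1)] by (auto simp: homeomorphism_def)
  \<comment> \<open>The Hausdorff property makes this compact set closed in the whole manifold, not
    only in the chart; hence \<open>f\<close> vanishes on an open complement.\<close>
  have "compact K"
    unfolding K_def
    by (rule compact_continuous_image[OF continuous_on_subset[OF hom(2)] compact_cball_fin_dim])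
      (use r in blast)
  then have "closed K" by (rule compact_imp_closed)
  have "open O'"
    using continuous_on_open_vimage[OF chart(1)[OF U(1)], of \<phi>] hom(1)
    by (simp add: O'_def Int_commute)
  have "O' \<subseteq> K"
  proof
    fix q assume "q \<in> O'"
    then have "q = inv_into U \<phi> (\<phi> q)" "\<phi> q \<in> cball (\<phi> p) r"
      using chart_inv[OF U(1)] by (auto simp: O'_def)
    then show "q \<in> K" unfolding K_def by blast
  qed
  have K: "K \<subseteq> U \<inter> W"
  proof
    fix q assume "q \<in> K"
    then obtain s where "s \<in> U \<inter> W" "q = inv_into U \<phi> (\<phi> s)"
      using r(2) unfolding K_def by blast
    then show "q \<in> U \<inter> W" by (simp add: chart_inv[OF U(1)])
  qed
  have supp: "f q \<noteq> 0 \<longleftrightarrow> q \<in> O'" for q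
  proof -
    have "(\<phi> q - \<phi> p) \<bullet> (\<phi> q - \<phi> p) < r\<^sup>2 \<longleftrightarrow> dist (\<phi> p) (\<phi> q) < r"
      using r(1) abs_le_square_iff[of r "norm (\<phi> p - \<phi> q)"]
      by (simp add: dot_square_norm dist_norm norm_minus_commute flip: not_le)
    then show ?thesis by (auto simp: f_def O'_def flat_exp_def)
  qed
  \<comment> \<open>Read in another chart, the coordinate map becomes a transition map, which is
    smooth by the atlas condition.\<close>
  have "smooth_fun_on C U (\<lambda>q. flat_exp 0 (r\<^sup>2 - (\<phi> q - \<phi> p) \<bullet> (\<phi> q - \<phi> p)))"
  proof (rule smooth_fun_onI)
    fix V \<psi> n assume V: "(V, \<psi>) \<in> C"
    let ?S = "\<psi> ` (V \<inter> U)"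
    have S: "open ?S" by (rule open_chart_image[OF V chart(1)[OF U(1)]])
    have "cn_on n ?S (\<lambda>x. \<phi> (inv_into V \<psi> x))"
      using chart_transition[OF V U(1)] by (simp add: smooth_on_def comp_def)
    from cn_on_add[OF S this cn_on_const, of "- \<phi> p"]
    have g: "cn_on n ?S (\<lambda>x. \<phi> (inv_into V \<psi> x) - \<phi> p)" by simp
    note neg = cn_on_bounded_linear[OF bounded_linear_minus[OF bounded_linear_ident] S
        cn_on_bilinear[OF bounded_bilinear_inner S g g]]
    show "cn_on n ?S (\<lambda>x. flat_exp 0 (r\<^sup>2 - (\<phi> (inv_into V \<psi> x) - \<phi> p) \<bullet> (\<phi> (inv_into V \<psi> x) - \<phi> p)))"
      using cn_on_flat_exp[OF S cn_on_add[OF S cn_on_const neg], of 0 "r\<^sup>2"] by simp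
  qed
  then have 1: "smooth_fun_on C U f"
    by (rule smooth_fun_on_cong[OF chart(1)[OF U(1)], rotated]) (simp add: f_def)
  have 2: "smooth_fun_on C (- K) f"
    by (rule smooth_fun_on_cong[OF _ _ smooth_fun_on_const[of _ 0]])
      (use \<open>closed K\<close> supp \<open>O' \<subseteq> K\<close> in \<open>auto intro: open_Compl\<close>)
  have "smooth_fun_on C UNIV f"
  \<comment> \<open>The chart domain and the complement of \<open>K\<close> cover the
    manifold.\<close>
  proof (rule smooth_fun_on_local)
    fix q show "\<exists>V. open V \<and> q \<in> V \<and> smooth_fun_on C V f"
      using 1 2 K open_Compl[OF \<open>closed K\<close>] chart(1)[OF U(1)] by (cases "q \<in> U") blast+
  qed
  moreover have "p \<in> O'" using U r by (simp add: O'_def)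
  ultimately show ?thesis
    using that \<open>closed K\<close> \<open>open O'\<close> \<open>O' \<subseteq> K\<close> K supp by blast
qed

end

section \<open>Sections of vector bundles\<close>

text \<open>The condition under which \<open>one_form_of\<close> denotes an actual dual
  section.\<close>

definition tensorial ::
  "('m, 'e::fin_dim_inner, 'a::fin_dim_inner) algebroid \<Rightarrow> (('m \<Rightarrow> 'a) \<Rightarrow> ('m \<Rightarrow> real)) \<Rightarrow> bool" where
  "tensorial A F \<longleftrightarrow>
     (\<forall>X\<in>sections A. F X \<in> smooth_functions A) \<and>
     (\<forall>X\<in>sections A. \<forall>Y\<in>sections A. F (\<lambda>q. X q + Y q) = (\<lambda>q. F X q + F Y q)) \<and>
     (\<forall>X\<in>sections A. \<forall>f\<in>smooth_functions A. F (\<lambda>q. f q *\<^sub>R X q) = (\<lambda>q. f q * F X q))"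

locale vbundle =
  fixes A :: "('m::{t2_space,second_countable_topology}, 'e::fin_dim_inner, 'a::fin_dim_inner) algebroid"
  assumes vector_bundle: "vector_bundle A"
begin

sublocale smooth_manifold "charts A"
  by unfold_locales (use vector_bundle in \<open>simp add: vector_bundle_def\<close>)

lemma triv_cover: "\<exists>U \<tau>. (U, \<tau>) \<in> trivs A \<and> p \<in> U"
proof -
  have "p \<in> (\<Union>(U, \<tau>)\<in>trivs A. U)"
    using vector_bundle by (simp add: vector_bundle_def)
  then show ?thesis by auto
qed

lemma triv:
  assumes "(U, \<tau>) \<in> trivs A"
  shows "open U" "p \<in> U \<Longrightarrow> linear (\<tau> p)" "p \<in> U \<Longrightarrow> bij (\<tau> p)"
proof -
  have "\<forall>(U, \<tau>)\<in>trivs A. open U \<and> (\<forall>p\<in>U. linear (\<tau> p) \<and> bij (\<tau> p))"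
    using vector_bundle unfolding vector_bundle_def by (elim conjE)
  from bspec[OF this assms]
  show "open U" "p \<in> U \<Longrightarrow> linear (\<tau> p)" "p \<in> U \<Longrightarrow> bij (\<tau> p)" by simp_all
qed

lemma triv_transition:
  assumes "(U, \<tau>) \<in> trivs A" "(V, \<sigma>) \<in> trivs A"
  shows "smooth_fun_on (charts A) (U \<inter> V) (\<lambda>p. \<sigma> p (inv (\<tau> p) v))"
proof -
  have "\<forall>(U, \<tau>)\<in>trivs A. \<forall>(V, \<sigma>)\<in>trivs A. \<forall>v.
      smooth_fun_on (charts A) (U \<inter> V) (\<lambda>p. \<sigma> p (inv (\<tau> p) v))"
    using vector_bundle unfolding vector_bundle_def by (elim conjE)
  from bspec[OF this assms(1)] show ?thesis
    using assms(2) by auto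
qed

lemma triv_inv:
  assumes "(U, \<tau>) \<in> trivs A" "p \<in> U"
  shows "inv (\<tau> p) (\<tau> p x) = x" "\<tau> p (inv (\<tau> p) v) = v" "linear (inv (\<tau> p))"
proof -
  note bij = triv(3)[OF assms]
  show 1: "inv (\<tau> p) (\<tau> p x) = x" for x
    by (rule inv_f_f[OF bij_is_inj[OF bij]])
  show 2: "\<tau> p (inv (\<tau> p) v) = v" for v
    by (rule surj_f_inv_f[OF bij_is_surj[OF bij]])
  note lin = triv(2)[OF assms]
  show "linear (inv (\<tau> p))"
  proof (rule linearI)
    show "inv (\<tau> p) (v + w) = inv (\<tau> p) v + inv (\<tau> p) w" for v w
      by (metis 1 2 linear_add[OF lin])
    show "inv (\<tau> p) (c *\<^sub>R v) = c *\<^sub>R inv (\<tau> p) v" for c v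
      by (metis 1 2 linear_scale[OF lin])
  qed
qed

lemma triv_expansion:
  assumes "(U, \<tau>) \<in> trivs A" "p \<in> U"
  shows "x = (\<Sum>b\<in>onb. (\<tau> p x \<bullet> b) *\<^sub>R inv (\<tau> p) b)"
  using linear_onb[OF triv_inv(3)[OF assms], of "\<tau> p x"] by (simp only: triv_inv(1)[OF assms])

lemma local_sectionsI:
  "(\<And>U \<tau>. (U, \<tau>) \<in> trivs A \<Longrightarrow> smooth_fun_on (charts A) (U \<inter> W) (\<lambda>p. \<tau> p (X p))) \<Longrightarrow>
    X \<in> local_sections A W"
  by (auto simp: local_sections_def)

lemma local_sectionsD:
  "X \<in> local_sections A W \<Longrightarrow> (U, \<tau>) \<in> trivs A \<Longrightarrow>
    smooth_fun_on (charts A) (U \<inter> W) (\<lambda>p. \<tau> p (X p))"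
  unfolding local_sections_def mem_Collect_eq by (drule (1) bspec) simp

lemma local_dual_sectionsI:
  "(\<And>U \<tau> v. (U, \<tau>) \<in> trivs A \<Longrightarrow> smooth_fun_on (charts A) (U \<inter> W) (\<lambda>p. blinfun_apply (\<alpha> p) (inv (\<tau> p) v))) \<Longrightarrow>
    \<alpha> \<in> local_dual_sections A W"
  by (auto simp: local_dual_sections_def)

lemma local_dual_sectionsD:
  "\<alpha> \<in> local_dual_sections A W \<Longrightarrow> (U, \<tau>) \<in> trivs A \<Longrightarrow>
    smooth_fun_on (charts A) (U \<inter> W) (\<lambda>p. blinfun_apply (\<alpha> p) (inv (\<tau> p) v))"
  unfolding local_dual_sections_def mem_Collect_eq by (drule (1) bspec) simp

text \<open>Expanding the argument in the local frame of a trivialisation reduces smoothness to the frame.\<close>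

lemma smooth_fun_on_linear_apply:
  fixes T :: "'m \<Rightarrow> 'a \<Rightarrow> 'f::real_normed_vector"
  assumes "open W" "(U, \<tau>) \<in> trivs A" "X \<in> local_sections A W"
    and "\<And>p. p \<in> U \<Longrightarrow> linear (T p)"
    and "\<And>v. smooth_fun_on (charts A) (U \<inter> W) (\<lambda>p. T p (inv (\<tau> p) v))"
  shows "smooth_fun_on (charts A) (U \<inter> W) (\<lambda>p. T p (X p))"
proof (rule smooth_fun_on_cong)
  show o: "open (U \<inter> W)" using assms(1) triv(1)[OF assms(2)] by blast
  show "smooth_fun_on (charts A) (U \<inter> W) (\<lambda>p. \<Sum>b\<in>onb. (\<tau> p (X p) \<bullet> b) *\<^sub>R T p (inv (\<tau> p) b))"
    by (intro smooth_fun_on_sum smooth_fun_on_scaleR o assms(5))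
      (rule smooth_fun_on_bounded_linear[OF bounded_linear_inner_left o local_sectionsD[OF assms(3,2)]])
  show "(\<Sum>b\<in>onb. (\<tau> p (X p) \<bullet> b) *\<^sub>R T p (inv (\<tau> p) b)) = T p (X p)" if "p \<in> U \<inter> W" for p
  proof -
    have p: "p \<in> U" using that by simp
    have "T p (X p) = T p (\<Sum>b\<in>onb. (\<tau> p (X p) \<bullet> b) *\<^sub>R inv (\<tau> p) b)"
      by (rule arg_cong[OF triv_expansion[OF assms(2) p]])
    then show ?thesis
      by (simp add: linear_sum[OF assms(4)[OF p]] linear_scale[OF assms(4)[OF p]])
  qed
qed

lemma frame_section: "(U, \<tau>) \<in> trivs A \<Longrightarrow> (\<lambda>p. inv (\<tau> p) v) \<in> local_sections A U"
  by (rule local_sectionsI, subst Int_commute, rule triv_transition)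

lemma smooth_pairing:
  assumes "open W" "\<alpha> \<in> local_dual_sections A W" "X \<in> local_sections A W"
  shows "smooth_fun_on (charts A) W (pairing \<alpha> X)"
proof (rule smooth_fun_on_local)
  fix p assume "p \<in> W"
  obtain U \<tau> where U: "(U, \<tau>) \<in> trivs A" "p \<in> U" using triv_cover by blast
  have "smooth_fun_on (charts A) (U \<inter> W) (pairing \<alpha> X)"
    unfolding pairing_def
    by (rule smooth_fun_on_linear_apply[OF assms(1) U(1) assms(3)])
      (auto intro: local_dual_sectionsD[OF assms(2) U(1)]
        bounded_linear.linear[OF blinfun.bounded_linear_right])
  then show "\<exists>V. open V \<and> p \<in> V \<and> smooth_fun_on (charts A) V (pairing \<alpha> X)"
    using \<open>p \<in> W\<close> U(2) assms(1) triv(1)[OF U(1)] by (intro exI[of _ "U \<inter> W"]) auto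
qed

lemma act_two_form:
  assumes "two_form A \<omega>" "open W" "X \<in> local_sections A W"
  shows "act \<omega> X \<in> local_dual_sections A W"
proof (rule local_dual_sectionsI)
  fix U \<tau> v assume U: "(U, \<tau>) \<in> trivs A"
  have sm: "smooth_fun_on (charts A) U (\<lambda>p. \<omega> p (inv (\<tau> p) w) (inv (\<tau> p) v))" for w
    using assms(1) U unfolding two_form_def by blast
  show "smooth_fun_on (charts A) (U \<inter> W) (\<lambda>p. act \<omega> X p (inv (\<tau> p) v))"
    unfolding act_def
    by (rule smooth_fun_on_linear_apply[OF assms(2) U assms(3)])
      (auto intro: smooth_fun_on_subset[OF sm] linearI simp: blinfun.add_right blinfun.add_left
        blinfun.scaleR_right blinfun.scaleR_left)
qed

lemma act_endomorphism:
  assumes "endomorphism A N" "open W" "X \<in> local_sections A W"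
  shows "act N X \<in> local_sections A W"
proof (rule local_sectionsI)
  fix U \<tau> assume U: "(U, \<tau>) \<in> trivs A"
  have sm: "smooth_fun_on (charts A) U (\<lambda>p. \<tau> p (N p (inv (\<tau> p) w)))" for w
    using assms(1) U unfolding endomorphism_def by blast
  show "smooth_fun_on (charts A) (U \<inter> W) (\<lambda>p. \<tau> p (act N X p))"
    unfolding act_def
    by (rule smooth_fun_on_linear_apply[OF assms(2) U assms(3)])
      (auto intro: smooth_fun_on_subset[OF sm] linearI simp: blinfun.add_right blinfun.scaleR_right
        linear_add[OF triv(2)[OF U]] linear_scale[OF triv(2)[OF U]])
qed

lemma two_form_form_comp:
  assumes "two_form A \<omega>" "endomorphism A N" "skew_symmetric (form_comp \<omega> N)"
  shows "two_form A (form_comp \<omega> N)"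
proof -
  have "smooth_fun_on (charts A) U (\<lambda>p. form_comp \<omega> N p (inv (\<tau> p) v) (inv (\<tau> p) w))"
    if U: "(U, \<tau>) \<in> trivs A" for U \<tau> v w
    using smooth_pairing[OF triv(1)[OF U] act_two_form[OF assms(1) triv(1)[OF U]
          act_endomorphism[OF assms(2) triv(1)[OF U] frame_section[OF U]]] frame_section[OF U]]
    by (simp add: pairing_def act_def form_comp_def)
  moreover have "form_comp \<omega> N p x x = 0" for p x
    using assms(3) unfolding skew_symmetric_def
    by (metis equal_neg_zero)
  ultimately show ?thesis
    unfolding two_form_def by auto
qed

lemma two_form_flat:
  assumes "two_form A \<omega>"
  shows "two_form A (flat \<omega>)"
  using assms triv(1) unfolding two_form_def flat_def
  by (auto simp: blinfun.minus_left intro!: smooth_fun_on_minus)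

section \<open>Operations on sections and extension by zero\<close>

lemma local_sections_add:
  assumes "open W" "X \<in> local_sections A W" "Y \<in> local_sections A W"
  shows "(\<lambda>p. X p + Y p) \<in> local_sections A W"
proof (rule local_sectionsI)
  fix U \<tau> assume U: "(U, \<tau>) \<in> trivs A"
  then have o: "open (U \<inter> W)" using assms(1) triv(1) by blast
  show "smooth_fun_on (charts A) (U \<inter> W) (\<lambda>p. \<tau> p (X p + Y p))"
    by (rule smooth_fun_on_cong[OF o _ smooth_fun_on_add[OF o local_sectionsD[OF assms(2) U]
            local_sectionsD[OF assms(3) U]]])
      (simp add: linear_add[OF triv(2)[OF U]])
qed

lemma local_sections_scaleR:
  assumes "open W" "smooth_fun_on (charts A) W f" "X \<in> local_sections A W"
  shows "(\<lambda>p. f p *\<^sub>R X p) \<in> local_sections A W"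
proof (rule local_sectionsI)
  fix U \<tau> assume U: "(U, \<tau>) \<in> trivs A"
  then have o: "open (U \<inter> W)" using assms(1) triv(1) by blast
  have f: "smooth_fun_on (charts A) (U \<inter> W) f"
    by (rule smooth_fun_on_subset[OF assms(2)]) simp
  show "smooth_fun_on (charts A) (U \<inter> W) (\<lambda>p. \<tau> p (f p *\<^sub>R X p))"
    by (rule smooth_fun_on_cong[OF o _ smooth_fun_on_scaleR[OF o f local_sectionsD[OF assms(3) U]]])
      (simp add: linear_scale[OF triv(2)[OF U]])
qed

lemma sections_scaleR_const:
  "X \<in> sections A \<Longrightarrow> (\<lambda>p. c *\<^sub>R X p) \<in> sections A"
  by (rule local_sections_scaleR[OF open_UNIV smooth_fun_on_const])

lemma sections_diff:
  "X \<in> sections A \<Longrightarrow> Y \<in> sections A \<Longrightarrow> (\<lambda>p. X p - Y p) \<in> sections A"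
  using local_sections_add[OF open_UNIV, of X "\<lambda>p. (-1) *\<^sub>R Y p"] sections_scaleR_const[of Y "-1"]
  by simp

text \<open>\<open>V\<close> is covered by the part inside \<open>W\<close>, where both factors are
  smooth, and the part off \<open>K\<close>, where the product vanishes whatever values
  \<open>g\<close> has.\<close>

lemma smooth_extension_by_zero:
  fixes g :: "'m \<Rightarrow> 'f::real_normed_vector"
  assumes "open W" "open V" "closed K" "K \<inter> V \<subseteq> W" "smooth_fun_on (charts A) V f"
    and "\<And>q. q \<notin> K \<Longrightarrow> f q = 0" "smooth_fun_on (charts A) (V \<inter> W) g"
  shows "smooth_fun_on (charts A) V (\<lambda>q. f q *\<^sub>R g q)"
proof (rule smooth_fun_on_local)
  have VW: "open (V \<inter> W)" "open (- K)" using assms(1-3) by auto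
  have f: "smooth_fun_on (charts A) (V \<inter> W) f"
    by (rule smooth_fun_on_subset[OF assms(5)]) simp
  have "smooth_fun_on (charts A) (V \<inter> W) (\<lambda>q. f q *\<^sub>R g q)"
    by (rule smooth_fun_on_scaleR[OF VW(1) f assms(7)])
  moreover have "smooth_fun_on (charts A) (- K) (\<lambda>q. f q *\<^sub>R g q)"
    by (rule smooth_fun_on_cong[OF VW(2) _ smooth_fun_on_const[of _ 0]]) (simp add: assms(6))
  moreover fix p assume "p \<in> V"
  ultimately show "\<exists>V. open V \<and> p \<in> V \<and> smooth_fun_on (charts A) V (\<lambda>q. f q *\<^sub>R g q)"
    using VW assms(4) by (cases "p \<in> K") blast+
qed

lemma section_extension_by_zero:
  assumes "open W" "closed K" "K \<subseteq> W" "smooth_fun_on (charts A) UNIV f"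
    and "\<And>q. q \<notin> K \<Longrightarrow> f q = 0" "X \<in> local_sections A W"
  shows "(\<lambda>q. f q *\<^sub>R X q) \<in> sections A"
proof (rule local_sectionsI)
  fix U \<tau> assume U: "(U, \<tau>) \<in> trivs A"
  have "smooth_fun_on (charts A) U (\<lambda>q. f q *\<^sub>R \<tau> q (X q))"
    by (rule smooth_extension_by_zero[OF assms(1) triv(1)[OF U] assms(2) _
          smooth_fun_on_subset[OF assms(4)] assms(5) local_sectionsD[OF assms(6) U]])
      (use assms(3) in auto)
  then show "smooth_fun_on (charts A) (U \<inter> UNIV) (\<lambda>p. \<tau> p (f p *\<^sub>R X p))"
    by (subst Int_UNIV_right, rule smooth_fun_on_cong[OF triv(1)[OF U], rotated])
      (simp add: linear_scale[OF triv(2)[OF U]])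
qed

text \<open>A locally constant section is cut off by a bump function; dividing the vector by
  \<open>f p\<close> beforehand compensates for the unknown value of the bump at
  \<open>p\<close>.\<close>

lemma ex_section_through: "\<exists>Z\<in>sections A. Z p = v"
proof -
  obtain U \<tau> where U: "(U, \<tau>) \<in> trivs A" "p \<in> U" using triv_cover by blast
  obtain f :: "'m \<Rightarrow> real" and O' K where f: "smooth_fun_on (charts A) UNIV f" "open O'" "closed K"
    "p \<in> O'" "O' \<subseteq> K" "K \<subseteq> U" "\<And>q. f q \<noteq> 0 \<longleftrightarrow> q \<in> O'"
    using ex_bump_function[OF triv(1)[OF U(1)] U(2)] by blast
  have "f p \<noteq> 0" using f by blast
  have "f q = 0" if "q \<notin> K" for q using f that by blast
  then have "(\<lambda>q. f q *\<^sub>R inv (\<tau> q) (\<tau> p v /\<^sub>R f p)) \<in> sections A"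
    by (rule section_extension_by_zero[OF triv(1)[OF U(1)] f(3,6,1) _ frame_section[OF U(1)]])
  moreover have "f p *\<^sub>R inv (\<tau> p) (\<tau> p v /\<^sub>R f p) = v"
    using \<open>f p \<noteq> 0\<close> by (simp add: linear_scale[OF triv_inv(3)[OF U]] triv_inv(1)[OF U])
  ultimately show ?thesis by (intro bexI)
qed

lemma pairing_eq_imp_eq:
  fixes \<alpha> \<beta> :: "'m \<Rightarrow> 'a \<Rightarrow>\<^sub>L real"
  assumes "\<And>Z. Z \<in> sections A \<Longrightarrow> pairing \<alpha> Z = pairing \<beta> Z"
  shows "\<alpha> = \<beta>"
proof (rule ext, rule blinfun_eqI)
  fix p v
  obtain Z where "Z \<in> sections A" "Z p = v" using ex_section_through by blast
  then show "\<alpha> p v = \<beta> p v" using fun_cong[OF assms, of Z p] by (simp add: pairing_def)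
qed

section \<open>Maps linear over the smooth functions are one-forms\<close>

context
  fixes F
  assumes F: "tensorial A F"
begin

lemma tensorial_smooth: "X \<in> sections A \<Longrightarrow> smooth_fun_on (charts A) UNIV (F X)"
  using F by (simp add: tensorial_def smooth_functions_def)

lemma tensorial_add:
  "X \<in> sections A \<Longrightarrow> Y \<in> sections A \<Longrightarrow> F (\<lambda>q. X q + Y q) = (\<lambda>q. F X q + F Y q)"
  using F unfolding tensorial_def by blast

lemma tensorial_scale:
  "X \<in> sections A \<Longrightarrow> smooth_fun_on (charts A) UNIV f \<Longrightarrow> F (\<lambda>q. f q *\<^sub>R X q) = (\<lambda>q. f q * F X q)"
  using F unfolding tensorial_def smooth_functions_def by blast

lemma tensorial_sum:
  assumes "finite B" "\<And>b. b \<in> B \<Longrightarrow> X b \<in> sections A" "\<And>b. b \<in> B \<Longrightarrow> smooth_fun_on (charts A) UNIV (c b)"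
  shows "(\<lambda>q. \<Sum>b\<in>B. c b q *\<^sub>R X b q) \<in> sections A \<and>
    F (\<lambda>q. \<Sum>b\<in>B. c b q *\<^sub>R X b q) = (\<lambda>q. \<Sum>b\<in>B. c b q * F (X b) q)"
  using assms
proof (induction B)
  case empty
  obtain Z where Z: "Z \<in> sections A" using ex_section_through by blast
  show ?case
    using tensorial_scale[OF Z smooth_fun_on_const[of _ 0]] sections_scaleR_const[OF Z, of 0] by simp
next
  case (insert b B)
  then have X: "X b \<in> sections A" "smooth_fun_on (charts A) UNIV (c b)" by auto
  note s = local_sections_scaleR[OF open_UNIV X(2,1)]
  have IH: "(\<lambda>q. \<Sum>b\<in>B. c b q *\<^sub>R X b q) \<in> sections A"
    "F (\<lambda>q. \<Sum>b\<in>B. c b q *\<^sub>R X b q) = (\<lambda>q. \<Sum>b\<in>B. c b q * F (X b) q)"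
    using insert by auto
  show ?case
    using tensorial_add[OF s IH(1)] local_sections_add[OF open_UNIV s IH(1)] insert.hyps
    by (simp add: tensorial_scale[OF X] IH(2))
qed

text \<open>
  If \<open>Z p = 0\<close>, then \<open>f\<^sup>2 Z\<close>, for a function \<open>f\<close> with \<open>f p \<noteq> 0\<close> supported in a trivialisation, is a
  combination of global sections with coefficients vanishing at \<open>p\<close>.
\<close>

lemma tensorial_zero:
  assumes "Z \<in> sections A" "Z p = 0"
  shows "F Z p = 0"
proof -
  obtain U \<tau> where U: "(U, \<tau>) \<in> trivs A" "p \<in> U" using triv_cover by blast
  obtain f :: "'m \<Rightarrow> real" and O' K where f: "smooth_fun_on (charts A) UNIV f" "open O'" "closed K"
    "p \<in> O'" "O' \<subseteq> K" "K \<subseteq> U" "\<And>q. f q \<noteq> 0 \<longleftrightarrow> q \<in> O'"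
    using ex_bump_function[OF triv(1)[OF U(1)] U(2)] by blast
  have "f p \<noteq> 0" using f by blast
  have supp: "f q = 0" if "q \<notin> K" for q using f that by blast
  \<comment> \<open>One factor \<open>f\<close> extends the frame to global sections, the other
    extends the coefficients to global functions.\<close>
  define e where "e b q = f q *\<^sub>R inv (\<tau> q) b" for b q
  define c where "c b q = f q *\<^sub>R (\<tau> q (Z q) \<bullet> b)" for b q
  have e: "e b \<in> sections A" for b
    unfolding e_def
    by (rule section_extension_by_zero[OF triv(1)[OF U(1)] f(3,6,1) supp frame_section[OF U(1)]])
  have "smooth_fun_on (charts A) U (\<lambda>q. \<tau> q (Z q) \<bullet> b)" for b
    using smooth_fun_on_bounded_linear[OF bounded_linear_inner_left triv(1)[OF U(1)]]
      local_sectionsD[OF assms(1) U(1)] by simp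
  then have c: "smooth_fun_on (charts A) UNIV (c b)" for b
    unfolding c_def
    by (intro smooth_extension_by_zero[OF triv(1)[OF U(1)] open_UNIV f(3) _ f(1) supp]) (use f(6) in auto)
  have "(\<lambda>q. (f q * f q) *\<^sub>R Z q) = (\<lambda>q. \<Sum>b\<in>onb. c b q *\<^sub>R e b q)"
  proof
    fix q
    show "(f q * f q) *\<^sub>R Z q = (\<Sum>b\<in>onb. c b q *\<^sub>R e b q)"
    proof (cases "q \<in> U")
      case True
      have "(f q * f q) *\<^sub>R Z q = (f q * f q) *\<^sub>R (\<Sum>b\<in>onb. (\<tau> q (Z q) \<bullet> b) *\<^sub>R inv (\<tau> q) b)"
        by (rule arg_cong[OF triv_expansion[OF U(1) True]])
      then show ?thesis
        by (simp add: c_def e_def scaleR_sum_right mult_ac)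
    next
      case False
      then have "f q = 0" using supp f(6) by blast
      then show ?thesis by (simp add: c_def)
    qed
  qed
  then have "F (\<lambda>q. (f q * f q) *\<^sub>R Z q) = (\<lambda>q. \<Sum>b\<in>onb. c b q * F (e b) q)"
    using tensorial_sum[OF onb(1), of e c] e c by simp
  moreover have "F (\<lambda>q. (f q * f q) *\<^sub>R Z q) = (\<lambda>q. (f q * f q) * F Z q)"
    by (rule tensorial_scale[OF assms(1) smooth_fun_on_mult[OF open_UNIV f(1) f(1)]])
  moreover have "c b p = 0" for b
    by (simp add: c_def assms(2) linear_0[OF triv(2)[OF U]])
  ultimately have "(f p * f p) * F Z p = 0"
    by (metis (no_types, lifting) mult_zero_left sum.neutral)
  then show ?thesis using \<open>f p \<noteq> 0\<close> by simp
qed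

lemma tensorial_pointwise:
  assumes "X \<in> sections A" "Y \<in> sections A" "X p = Y p"
  shows "F X p = F Y p"
proof -
  note Y = sections_scaleR_const[OF assms(2), of "-1"]
  have "F (\<lambda>q. X q + (-1) *\<^sub>R Y q) p = 0"
    by (rule tensorial_zero[OF local_sections_add[OF open_UNIV assms(1) Y]]) (simp add: assms(3))
  then show ?thesis
    unfolding tensorial_add[OF assms(1) Y] tensorial_scale[OF assms(2) smooth_fun_on_const] by simp
qed

text \<open>The value on a vector is that of \<open>F\<close> on a chosen global section through it;
  by \<open>tensorial_pointwise\<close> the choice is immaterial, which gives both linearity and the
  pairing formula.\<close>

lemma tensorial_imp_one_form: "\<exists>\<zeta>\<in>dual_sections A. \<forall>Z\<in>sections A. pairing \<zeta> Z = F Z"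
proof -
  define s where "s p v = (SOME Z. Z \<in> sections A \<and> Z p = v)" for p v
  have s: "s p v \<in> sections A" "s p v p = v" for p v
    using someI_ex[of "\<lambda>Z. Z \<in> sections A \<and> Z p = v"] ex_section_through by (auto simp: s_def)
  define \<zeta> where "\<zeta> p = Blinfun (\<lambda>v. F (s p v) p)" for p
  have "linear (\<lambda>v. F (s p v) p)" for p
  proof (rule linearI)
    fix v w c
    have "F (s p (v + w)) p = F (\<lambda>q. s p v q + s p w q) p"
      by (rule tensorial_pointwise[OF s(1) local_sections_add[OF open_UNIV s(1) s(1)]]) (simp add: s(2))
    then show "F (s p (v + w)) p = F (s p v) p + F (s p w) p"
      by (simp add: tensorial_add s(1))
    have "F (s p (c *\<^sub>R v)) p = F (\<lambda>q. c *\<^sub>R s p v q) p"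
      by (rule tensorial_pointwise[OF s(1) sections_scaleR_const[OF s(1)]]) (simp add: s(2))
    then show "F (s p (c *\<^sub>R v)) p = c *\<^sub>R F (s p v) p"
      by (simp add: tensorial_scale[OF s(1) smooth_fun_on_const])
  qed
  then have app: "\<zeta> p v = F (s p v) p" for p v
    unfolding \<zeta>_def by (simp add: bounded_linear_Blinfun_apply linear_imp_bounded)
  have pair: "pairing \<zeta> Z = F Z" if "Z \<in> sections A" for Z
    unfolding pairing_def by (rule ext) (simp add: app tensorial_pointwise[OF s(1) that] s(2))
  have "\<zeta> \<in> dual_sections A"
  proof (rule local_dual_sectionsI, rule smooth_fun_on_local)
    fix U \<tau> v p assume U: "(U, \<tau>) \<in> trivs A" and "p \<in> U \<inter> UNIV"
    then have "p \<in> U" by simp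
    obtain f :: "'m \<Rightarrow> real" and O' K where f: "smooth_fun_on (charts A) UNIV f" "open O'" "closed K"
      "p \<in> O'" "O' \<subseteq> K" "K \<subseteq> U" "\<And>q. f q \<noteq> 0 \<longleftrightarrow> q \<in> O'"
      using ex_bump_function[OF triv(1)[OF U] \<open>p \<in> U\<close>] by blast
    have supp: "f q = 0" if "q \<notin> K" for q using f that by blast
    \<comment> \<open>The frame itself is not global. \<open>F\<close> is evaluated on its cut-off,
      and \<open>f\<close> is divided out again on \<open>O'\<close>, where it does not
      vanish.\<close>
    have Z: "(\<lambda>q. f q *\<^sub>R inv (\<tau> q) v) \<in> sections A" (is "?Z \<in> _")
      by (rule section_extension_by_zero[OF triv(1)[OF U] f(3,6,1) supp frame_section[OF U]])
    have "smooth_fun_on (charts A) O' (\<lambda>q. inverse (f q) * F ?Z q)"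
      by (intro smooth_fun_on_mult[OF f(2)] smooth_fun_on_inverse[OF f(2)]
          smooth_fun_on_subset[OF f(1)] smooth_fun_on_subset[OF tensorial_smooth[OF Z]]) (auto simp: f(7))
    moreover have "inverse (f q) * F ?Z q = \<zeta> q (inv (\<tau> q) v)" if "q \<in> O'" for q
    proof -
      have "F ?Z q = f q * \<zeta> q (inv (\<tau> q) v)"
        unfolding pair[OF Z, symmetric] pairing_def by (simp add: blinfun.scaleR_right)
      moreover have "f q \<noteq> 0" using f(7) that by blast
      ultimately show ?thesis by simp
    qed
    ultimately have "smooth_fun_on (charts A) O' (\<lambda>q. \<zeta> q (inv (\<tau> q) v))"
      by (rule smooth_fun_on_cong[OF f(2), rotated])
    then show "\<exists>V. open V \<and> p \<in> V \<and> smooth_fun_on (charts A) V (\<lambda>q. \<zeta> q (inv (\<tau> q) v))"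
      using f(2,4) by blast
  qed
  then show ?thesis using pair by blast
qed

lemma one_form_of_tensorial:
  "one_form_of A F \<in> dual_sections A" "Z \<in> sections A \<Longrightarrow> pairing (one_form_of A F) Z = F Z"
proof -
  obtain \<zeta> where \<zeta>: "\<zeta> \<in> dual_sections A" "\<forall>Z\<in>sections A. pairing \<zeta> Z = F Z"
    using tensorial_imp_one_form by blast
  have "one_form_of A F = \<zeta>"
    unfolding one_form_of_def
    by (rule the_equality) (use \<zeta> pairing_eq_imp_eq in auto)
  then show "one_form_of A F \<in> dual_sections A" "Z \<in> sections A \<Longrightarrow> pairing (one_form_of A F) Z = F Z"
    using \<zeta> by simp_all
qed

end

end

section \<open>Closed 2-forms and Dirac structures\<close>

lemma pairing_add_right: "pairing \<alpha> (\<lambda>q. X q + Y q) = (\<lambda>q. pairing \<alpha> X q + pairing \<alpha> Y q)"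
  by (simp add: pairing_def blinfun.add_right)

lemma pairing_scaleR_right: "pairing \<alpha> (\<lambda>q. f q *\<^sub>R X q) = (\<lambda>q. f q * pairing \<alpha> X q)"
  by (simp add: pairing_def blinfun.scaleR_right)

lemma pairing_act_flat: "pairing (act (flat \<omega>) X) Y = (\<lambda>p. - eval2 \<omega> X Y p)"
  by (simp add: pairing_def act_def flat_def eval2_def blinfun.minus_left)

lemma eval2_form_comp: "eval2 (form_comp \<omega> N) X Y = eval2 \<omega> (act N X) Y"
  by (simp add: eval2_def act_def form_comp_def)

lemma eval2_skew: "skew_symmetric \<omega> \<Longrightarrow> eval2 \<omega> X Y p = - eval2 \<omega> Y X p"
  unfolding skew_symmetric_def eval2_def by blast

lemma two_form_skew_symmetric:
  assumes "two_form A \<omega>"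
  shows "skew_symmetric \<omega>"
  unfolding skew_symmetric_def
proof (intro allI)
  fix p x y
  have alt: "\<omega> p z z = 0" for z
    using assms unfolding two_form_def by blast
  have "\<omega> p (x + y) (x + y) = \<omega> p x y + \<omega> p y x"
    using alt[of x] alt[of y] by (simp only: blinfun.add_left blinfun.add_right)
  then show "\<omega> p x y = - \<omega> p y x"
    using alt[of "x + y"] by simp
qed

text \<open>Isotropy is skewness. For maximality, an element \<open>(y, \<eta>)\<close> of a larger
  isotropic space is orthogonal to every element of the graph over \<open>x\<close>, and this
  already determines \<eta> on every \<open>x\<close>.\<close>

lemma maximally_isotropic_graph:
  assumes "skew_symmetric \<omega>"
  shows "maximally_isotropic (graph \<omega> p)"
  unfolding maximally_isotropic_def
proof (intro conjI allI impI)
  have skew: "\<omega> p x y + \<omega> p y x = 0" for x y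
  proof -
    have "\<omega> p x y = - \<omega> p y x"
      using assms unfolding skew_symmetric_def by blast
    then show ?thesis by simp
  qed
  show "subspace (graph \<omega> p)"
  proof -
    have lin: "linear (\<lambda>x. (x, flat \<omega> p x))"
      by (rule linearI) (simp_all add: blinfun.add_right blinfun.scaleR_right)
    have eq: "graph \<omega> p = range (\<lambda>x. (x, flat \<omega> p x))"
      by (auto simp: graph_def)
    show ?thesis
      unfolding eq by (rule linear_subspace_image[OF lin subspace_UNIV])
  qed
  show "isotropic (graph \<omega> p)"
    unfolding isotropic_def
  proof clarify
    fix x \<xi> y \<eta> assume "(x, \<xi>) \<in> graph \<omega> p" "(y, \<eta>) \<in> graph \<omega> p"
    then have "\<xi> y = - \<omega> p x y" "\<eta> x = - \<omega> p y x"
      by (auto simp: graph_def flat_def blinfun.minus_left)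
    then show "\<xi> y + \<eta> x = 0" using skew[of x y] by linarith
  qed
  fix V assume V: "subspace V \<and> isotropic V \<and> graph \<omega> p \<subseteq> V"
  have "\<eta> = flat \<omega> p y" if "(y, \<eta>) \<in> V" for y \<eta>
  proof (rule blinfun_eqI)
    fix x
    have "(x, flat \<omega> p x) \<in> V"
      using V by (auto simp: graph_def)
    moreover have iso: "\<forall>(x, \<xi>)\<in>V. \<forall>(y, \<eta>)\<in>V. blinfun_apply \<xi> y + blinfun_apply \<eta> x = 0"
      using V unfolding isotropic_def by blast
    ultimately have "flat \<omega> p x y + \<eta> x = 0"
      using that by fast
    then show "\<eta> x = flat \<omega> p y x"
      using skew[of x y] by (simp add: flat_def blinfun.minus_left)
  qed
  then have "V \<subseteq> graph \<omega> p" by (auto simp: graph_def)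
  then show "V = graph \<omega> p" using V by blast
qed

context vbundle
begin

lemma tensorialI:
  assumes "\<And>Z. Z \<in> sections A \<Longrightarrow> smooth_fun_on (charts A) UNIV (F Z)"
    and "\<And>Z Y. Z \<in> sections A \<Longrightarrow> Y \<in> sections A \<Longrightarrow> F (\<lambda>q. Z q + Y q) = (\<lambda>p. F Z p + F Y p)"
    and "\<And>Z f. Z \<in> sections A \<Longrightarrow> smooth_fun_on (charts A) UNIV f \<Longrightarrow>
      F (\<lambda>q. f q *\<^sub>R Z q) = (\<lambda>p. f p * F Z p)"
  shows "tensorial A F"
  using assms by (simp add: tensorial_def smooth_functions_def)

text \<open>Smoothness of the dual component is automatic, since a 2-form takes smooth sections to
  smooth dual sections.\<close>

lemma sections_of_graph:
  assumes "two_form A \<omega>"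
  shows "(X, \<xi>) \<in> sections_of A (graph \<omega>) \<longleftrightarrow> X \<in> sections A \<and> \<xi> = act (flat \<omega>) X"
proof -
  have "(\<forall>p. (X p, \<xi> p) \<in> graph \<omega> p) \<longleftrightarrow> \<xi> = act (flat \<omega>) X"
    by (auto simp: graph_def act_def fun_eq_iff)
  then show ?thesis
    using act_two_form[OF two_form_flat[OF assms] open_UNIV] by (auto simp: sections_of_def)
qed

lemma subbundle_graph:
  assumes "two_form A \<omega>"
  shows "subbundle A (graph \<omega>)"
  unfolding subbundle_def
proof (intro conjI allI)
  show "subspace (graph \<omega> p)" for p
    using maximally_isotropic_graph[OF two_form_skew_symmetric[OF assms]]
    by (simp add: maximally_isotropic_def)
  fix p
  obtain U \<tau> where U: "(U, \<tau>) \<in> trivs A" "p \<in> U" using triv_cover by blast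
  define e where "e b = (\<lambda>q. inv (\<tau> q) b)" for b
  define S where "S = (\<lambda>b. (e b, act (flat \<omega>) (e b))) ` onb"
  have e: "e b \<in> local_sections A U" for b
    unfolding e_def by (rule frame_section[OF U(1)])
  have S: "finite S" "S \<subseteq> local_sections A U \<times> local_dual_sections A U"
    using e act_two_form[OF two_form_flat[OF assms] triv(1)[OF U(1)] e] onb(1) by (auto simp: S_def)
  have frame: "inj_on (\<lambda>(X, \<xi>). (X q, \<xi> q)) S \<and>
      independent ((\<lambda>(X, \<xi>). (X q, \<xi> q)) ` S) \<and>
      span ((\<lambda>(X, \<xi>). (X q, \<xi> q)) ` S) = graph \<omega> q" if q: "q \<in> U" for q
  proof -
    \<comment> \<open>The frame at \<open>q\<close> is the image of \<open>onb\<close> under this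
      linear map; its first component makes it injective, so independence carries over.\<close>
    define g where "g v = (inv (\<tau> q) v, flat \<omega> q (inv (\<tau> q) v))" for v
    note lin = triv_inv(3)[OF U(1) q]
    have "linear g"
      by (rule linearI)
        (simp_all add: g_def linear_add[OF lin] linear_scale[OF lin] blinfun.add_right blinfun.scaleR_right)
    have "inj g"
      by (rule injI) (metis g_def prod.inject triv_inv(2)[OF U(1) q])
    have img: "(\<lambda>(X, \<xi>). (X q, \<xi> q)) ` S = g ` onb"
      by (force simp: S_def g_def e_def act_def)
    have "range g = graph \<omega> q"
      unfolding g_def graph_def using triv_inv(1)[OF U(1) q] by (auto simp: image_iff) metis
    then have "span (g ` onb) = graph \<omega> q"
      using linear_span_image[OF \<open>linear g\<close>, of onb] onb(4)[where 'a='a] by simp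
    moreover have "independent (g ` onb)"
      by (rule linear_independent_injective_image[OF \<open>linear g\<close> independent_onb
          inj_on_subset[OF \<open>inj g\<close> subset_UNIV]])
    moreover have "inj_on (\<lambda>(X, \<xi>). (X q, \<xi> q)) S"
      using \<open>inj g\<close> by (auto simp: S_def inj_on_def g_def e_def act_def)
    ultimately show ?thesis by (simp add: img)
  qed
  show "\<exists>W S. open W \<and> p \<in> W \<and> finite S \<and> S \<subseteq> local_sections A W \<times> local_dual_sections A W \<and>
      (\<forall>q\<in>W. inj_on (\<lambda>(X, \<xi>). (X q, \<xi> q)) S \<and> independent ((\<lambda>(X, \<xi>). (X q, \<xi> q)) ` S) \<and>
        span ((\<lambda>(X, \<xi>). (X q, \<xi> q)) ` S) = graph \<omega> q)"
    by (intro exI[of _ U] exI[of _ S]) (use S frame U(2) triv(1)[OF U(1)] in blast)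
qed

lemma relation_of_pair_graph:
  assumes "two_form A \<omega>" "two_form A (form_comp \<omega> N)"
  shows "relation_of_pair A (graph \<omega>) (graph (form_comp \<omega> N)) = rel_N A \<omega> N"
  using act_two_form[OF two_form_flat[OF assms(1)] open_UNIV]
  by (auto simp: relation_of_pair_def rel_N_def sections_of_graph[OF assms(1)] sections_of_graph[OF assms(2)])

end

section \<open>Bracket and anchor of a Lie algebroid\<close>

locale lie_algd =
  fixes A :: "('m::{t2_space,second_countable_topology}, 'e::fin_dim_inner, 'a::fin_dim_inner) algebroid"
  assumes lie_algebroid: "lie_algebroid A"
begin

sublocale vbundle A
  by unfold_locales (use lie_algebroid in \<open>simp add: lie_algebroid_def\<close>)

lemma anchor_map: "anchor_map A"
  using lie_algebroid by (simp add: lie_algebroid_def)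

lemma bracket_section: "X \<in> sections A \<Longrightarrow> Y \<in> sections A \<Longrightarrow> bracket A X Y \<in> sections A"
  using lie_algebroid unfolding lie_algebroid_def by blast

lemma bracket_skew:
  assumes "X \<in> sections A" "Y \<in> sections A"
  shows "bracket A X Y p = - bracket A Y X p"
proof -
  have "bracket A X Y = (\<lambda>p. - bracket A Y X p)"
    using lie_algebroid assms unfolding lie_algebroid_def by blast
  then show ?thesis by (rule fun_cong)
qed

lemma bracket_add_left:
  assumes "X \<in> sections A" "Y \<in> sections A" "Z \<in> sections A"
  shows "bracket A (\<lambda>q. X q + Y q) Z = (\<lambda>q. bracket A X Z q + bracket A Y Z q)"
proof -
  have "\<forall>X\<in>sections A. \<forall>Y\<in>sections A. \<forall>Z\<in>sections A. \<forall>c.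
      bracket A (\<lambda>p. c *\<^sub>R X p + Y p) Z = (\<lambda>p. c *\<^sub>R bracket A X Z p + bracket A Y Z p)"
    using lie_algebroid unfolding lie_algebroid_def by (elim conjE)
  then have "bracket A (\<lambda>q. 1 *\<^sub>R X q + Y q) Z = (\<lambda>q. 1 *\<^sub>R bracket A X Z q + bracket A Y Z q)"
    using assms by blast
  then show ?thesis by simp
qed

lemma bracket_add_right:
  assumes "X \<in> sections A" "Y \<in> sections A" "Z \<in> sections A"
  shows "bracket A X (\<lambda>q. Y q + Z q) = (\<lambda>q. bracket A X Y q + bracket A X Z q)"
  by (rule ext) (simp add: bracket_skew[OF assms(1)] assms bracket_add_left local_sections_add)

lemma bracket_scaleR_right:
  assumes "X \<in> sections A" "Y \<in> sections A" "smooth_fun_on (charts A) UNIV f"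
  shows "bracket A X (\<lambda>q. f q *\<^sub>R Y q) = (\<lambda>q. f q *\<^sub>R bracket A X Y q + anchor_deriv A X f q *\<^sub>R Y q)"
proof -
  have "f \<in> smooth_functions A" using assms(3) by (simp add: smooth_functions_def)
  then show ?thesis
    using lie_algebroid assms(1,2) unfolding lie_algebroid_def by blast
qed

lemma anchor_tangent_vector: "tangent_vector (charts A) p (anchor A p a)"
  using anchor_map unfolding anchor_map_def by blast

lemma anchor_linear: "smooth_fun_on (charts A) UNIV f \<Longrightarrow> linear (\<lambda>a. anchor A p a f)"
  using anchor_map unfolding anchor_map_def smooth_functions_def by blast

lemma anchor_deriv_smooth:
  "X \<in> sections A \<Longrightarrow> smooth_fun_on (charts A) UNIV f \<Longrightarrow> smooth_fun_on (charts A) UNIV (anchor_deriv A X f)"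
  using anchor_map unfolding anchor_map_def smooth_functions_def by blast

lemma anchor_deriv_add:
  "smooth_fun_on (charts A) UNIV f \<Longrightarrow> smooth_fun_on (charts A) UNIV g \<Longrightarrow>
    anchor_deriv A X (\<lambda>q. f q + g q) p = anchor_deriv A X f p + anchor_deriv A X g p"
  using anchor_tangent_vector[of p "X p"] unfolding tangent_vector_def anchor_deriv_def by blast

lemma anchor_deriv_mult:
  "smooth_fun_on (charts A) UNIV f \<Longrightarrow> smooth_fun_on (charts A) UNIV g \<Longrightarrow>
    anchor_deriv A X (\<lambda>q. f q * g q) p = f p * anchor_deriv A X g p + g p * anchor_deriv A X f p"
  using anchor_tangent_vector[of p "X p"] unfolding tangent_vector_def anchor_deriv_def by blast

lemma anchor_deriv_cmult:
  "smooth_fun_on (charts A) UNIV f \<Longrightarrow> anchor_deriv A X (\<lambda>q. c * f q) p = c * anchor_deriv A X f p"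
  using anchor_tangent_vector[of p "X p"] unfolding tangent_vector_def anchor_deriv_def by blast

lemma anchor_deriv_minus:
  "smooth_fun_on (charts A) UNIV f \<Longrightarrow> anchor_deriv A X (\<lambda>q. - f q) p = - anchor_deriv A X f p"
  using anchor_deriv_cmult[of f X "-1" p] by simp

lemma anchor_deriv_zero: "anchor_deriv A X (\<lambda>q. 0) p = 0"
  using anchor_deriv_cmult[OF smooth_fun_on_const, of X 0 0 p] by simp

lemma smooth_pairing_UNIV:
  "\<alpha> \<in> dual_sections A \<Longrightarrow> X \<in> sections A \<Longrightarrow> smooth_fun_on (charts A) UNIV (pairing \<alpha> X)"
  by (rule smooth_pairing[OF open_UNIV])

section \<open>The Dorfman bracket on the graph of a 2-form\<close>

lemma tensorial_lie_derivative:
  assumes "X \<in> sections A" "\<eta> \<in> dual_sections A"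
  shows "tensorial A (\<lambda>Z p. anchor_deriv A X (pairing \<eta> Z) p - pairing \<eta> (bracket A X Z) p)"
proof (rule tensorialI)
  fix Z assume Z: "Z \<in> sections A"
  note sm = smooth_pairing_UNIV[OF assms(2)]
  show "smooth_fun_on (charts A) UNIV (\<lambda>p. anchor_deriv A X (pairing \<eta> Z) p - pairing \<eta> (bracket A X Z) p)"
    by (intro smooth_fun_on_diff anchor_deriv_smooth sm bracket_section assms Z open_UNIV)
  show "(\<lambda>p. anchor_deriv A X (pairing \<eta> (\<lambda>q. Z q + Y q)) p - pairing \<eta> (bracket A X (\<lambda>q. Z q + Y q)) p) =
      (\<lambda>p. anchor_deriv A X (pairing \<eta> Z) p - pairing \<eta> (bracket A X Z) p +
        (anchor_deriv A X (pairing \<eta> Y) p - pairing \<eta> (bracket A X Y) p))" if "Y \<in> sections A" for Y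
    by (rule ext) (simp add: pairing_add_right bracket_add_right anchor_deriv_add sm assms Z that)
  \<comment> \<open>The terms with the derivative of \<open>f\<close> along \<open>X\<close>, one
    from the anchor and one from the bracket, cancel.\<close>
  show "(\<lambda>p. anchor_deriv A X (pairing \<eta> (\<lambda>q. f q *\<^sub>R Z q)) p - pairing \<eta> (bracket A X (\<lambda>q. f q *\<^sub>R Z q)) p) =
      (\<lambda>p. f p * (anchor_deriv A X (pairing \<eta> Z) p - pairing \<eta> (bracket A X Z) p))"
    if "smooth_fun_on (charts A) UNIV f" for f
    by (rule ext) (simp add: pairing_scaleR_right pairing_add_right bracket_scaleR_right anchor_deriv_mult
        sm assms Z that algebra_simps)
qed

lemma tensorial_contract_diff:
  assumes "Y \<in> sections A" "\<xi> \<in> dual_sections A"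
  shows "tensorial A (\<lambda>Z. diff1 A \<xi> Y Z)"
  unfolding diff1_def
proof (rule tensorialI)
  fix Z assume Z: "Z \<in> sections A"
  note sm = smooth_pairing_UNIV[OF assms(2)]
  \<comment> \<open>In one term \<open>Z\<close> is the direction of differentiation; there
    linearity comes from the anchor being linear on fibres.\<close>
  note lin = anchor_linear[OF sm[OF assms(1)]]
  show "smooth_fun_on (charts A) UNIV (\<lambda>p. anchor_deriv A Y (pairing \<xi> Z) p -
      anchor_deriv A Z (pairing \<xi> Y) p - pairing \<xi> (bracket A Y Z) p)"
    by (intro smooth_fun_on_diff anchor_deriv_smooth sm bracket_section assms Z open_UNIV)
  show "(\<lambda>p. anchor_deriv A Y (pairing \<xi> (\<lambda>q. Z q + X q)) p - anchor_deriv A (\<lambda>q. Z q + X q) (pairing \<xi> Y) p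
        - pairing \<xi> (bracket A Y (\<lambda>q. Z q + X q)) p) =
      (\<lambda>p. anchor_deriv A Y (pairing \<xi> Z) p - anchor_deriv A Z (pairing \<xi> Y) p - pairing \<xi> (bracket A Y Z) p +
        (anchor_deriv A Y (pairing \<xi> X) p - anchor_deriv A X (pairing \<xi> Y) p - pairing \<xi> (bracket A Y X) p))"
    if "X \<in> sections A" for X
  proof
    fix p
    have "anchor_deriv A (\<lambda>q. Z q + X q) (pairing \<xi> Y) p =
        anchor_deriv A Z (pairing \<xi> Y) p + anchor_deriv A X (pairing \<xi> Y) p"
      unfolding anchor_deriv_def by (rule linear_add[OF lin])
    then show "anchor_deriv A Y (pairing \<xi> (\<lambda>q. Z q + X q)) p - anchor_deriv A (\<lambda>q. Z q + X q) (pairing \<xi> Y) p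
        - pairing \<xi> (bracket A Y (\<lambda>q. Z q + X q)) p =
      anchor_deriv A Y (pairing \<xi> Z) p - anchor_deriv A Z (pairing \<xi> Y) p - pairing \<xi> (bracket A Y Z) p +
        (anchor_deriv A Y (pairing \<xi> X) p - anchor_deriv A X (pairing \<xi> Y) p - pairing \<xi> (bracket A Y X) p)"
      by (simp add: pairing_add_right bracket_add_right anchor_deriv_add sm assms Z that)
  qed
  show "(\<lambda>p. anchor_deriv A Y (pairing \<xi> (\<lambda>q. f q *\<^sub>R Z q)) p - anchor_deriv A (\<lambda>q. f q *\<^sub>R Z q) (pairing \<xi> Y) p
        - pairing \<xi> (bracket A Y (\<lambda>q. f q *\<^sub>R Z q)) p) =
      (\<lambda>p. f p * (anchor_deriv A Y (pairing \<xi> Z) p - anchor_deriv A Z (pairing \<xi> Y) p - pairing \<xi> (bracket A Y Z) p))"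
    if "smooth_fun_on (charts A) UNIV f" for f
  proof
    fix p
    have "anchor_deriv A (\<lambda>q. f q *\<^sub>R Z q) (pairing \<xi> Y) p = f p * anchor_deriv A Z (pairing \<xi> Y) p"
      unfolding anchor_deriv_def using linear_scale[OF lin] by simp
    then show "anchor_deriv A Y (pairing \<xi> (\<lambda>q. f q *\<^sub>R Z q)) p - anchor_deriv A (\<lambda>q. f q *\<^sub>R Z q) (pairing \<xi> Y) p
        - pairing \<xi> (bracket A Y (\<lambda>q. f q *\<^sub>R Z q)) p =
      f p * (anchor_deriv A Y (pairing \<xi> Z) p - anchor_deriv A Z (pairing \<xi> Y) p - pairing \<xi> (bracket A Y Z) p)"
      by (simp add: pairing_scaleR_right pairing_add_right bracket_scaleR_right anchor_deriv_mult
          sm assms Z that algebra_simps)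
  qed
qed

lemma act_flat_section: "two_form A \<omega> \<Longrightarrow> X \<in> sections A \<Longrightarrow> act (flat \<omega>) X \<in> dual_sections A"
  by (rule act_two_form[OF two_form_flat open_UNIV])

lemma smooth_eval2:
  "two_form A \<omega> \<Longrightarrow> X \<in> sections A \<Longrightarrow> Y \<in> sections A \<Longrightarrow> smooth_fun_on (charts A) UNIV (eval2 \<omega> X Y)"
  using smooth_pairing[OF open_UNIV act_two_form[OF _ open_UNIV], of \<omega> X Y]
  by (simp add: pairing_def act_def eval2_def)

text \<open>Five of the six terms of \<open>diff2\<close> occur with the opposite sign, two from the
  Lie derivative and three from the contraction; the sixth is supplied by \<omega> applied to the
  bracket of \<open>X\<close> and \<open>Y\<close>. The signs reflect \<open>flat\<close>, which is
  minus the contraction.\<close>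

lemma dorfman_graph:
  assumes "two_form A \<omega>" "X \<in> sections A" "Y \<in> sections A" "Z \<in> sections A"
  shows "pairing (\<lambda>p. lie_derivative A X (act (flat \<omega>) Y) p - contract_diff A Y (act (flat \<omega>) X) p) Z p
    = pairing (act (flat \<omega>) (bracket A X Y)) Z p - diff2 A \<omega> X Y Z p"
proof -
  note flat = act_flat_section[OF assms(1)]
  have "pairing (lie_derivative A X (act (flat \<omega>) Y)) Z p =
      - anchor_deriv A X (eval2 \<omega> Y Z) p + eval2 \<omega> Y (bracket A X Z) p"
    unfolding lie_derivative_def one_form_of_tensorial(2)[OF
        tensorial_lie_derivative[OF assms(2) flat[OF assms(3)]] assms(4)]
    by (simp add: pairing_act_flat anchor_deriv_minus smooth_eval2 assms)
  moreover have "pairing (contract_diff A Y (act (flat \<omega>) X)) Z p =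
      - anchor_deriv A Y (eval2 \<omega> X Z) p + anchor_deriv A Z (eval2 \<omega> X Y) p + eval2 \<omega> X (bracket A Y Z) p"
    unfolding contract_diff_def one_form_of_tensorial(2)[OF
        tensorial_contract_diff[OF assms(3) flat[OF assms(2)]] assms(4)]
    by (simp add: diff1_def pairing_act_flat anchor_deriv_minus smooth_eval2 assms)
  moreover have "eval2 \<omega> Y (bracket A X Z) p = - eval2 \<omega> (bracket A X Z) Y p"
    "eval2 \<omega> X (bracket A Y Z) p = - eval2 \<omega> (bracket A Y Z) X p"
    by (rule eval2_skew[OF two_form_skew_symmetric[OF assms(1)]])+
  ultimately show ?thesis
    by (simp add: pairing_act_flat diff2_def) (simp add: pairing_def blinfun.diff_left)
qed

lemma dirac_structure_graph_iff:
  assumes "two_form A \<omega>"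
  shows "dirac_structure A (graph \<omega>) \<longleftrightarrow> closed_two_form A \<omega>"
proof -
  define \<Phi> where "\<Phi> X Y = (\<lambda>p. lie_derivative A X (act (flat \<omega>) Y) p - contract_diff A Y (act (flat \<omega>) X) p)"
    for X Y
  have "dorfman A (X, act (flat \<omega>) X) (Y, act (flat \<omega>) Y) \<in> sections_of A (graph \<omega>) \<longleftrightarrow>
      (\<forall>Z\<in>sections A. diff2 A \<omega> X Y Z = (\<lambda>p. 0))" if XY: "X \<in> sections A" "Y \<in> sections A" for X Y
  proof -
    have "dorfman A (X, act (flat \<omega>) X) (Y, act (flat \<omega>) Y) \<in> sections_of A (graph \<omega>) \<longleftrightarrow>
        \<Phi> X Y = act (flat \<omega>) (bracket A X Y)"
      by (simp add: dorfman_def \<Phi>_def sections_of_graph[OF assms] bracket_section XY)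
    \<comment> \<open>Global sections separate dual sections, so an equality of one-forms becomes
      one of functions.\<close>
    also have "\<dots> \<longleftrightarrow> (\<forall>Z\<in>sections A. pairing (\<Phi> X Y) Z = pairing (act (flat \<omega>) (bracket A X Y)) Z)"
      using pairing_eq_imp_eq[of "\<Phi> X Y"] by auto
    also have "\<dots> \<longleftrightarrow> (\<forall>Z\<in>sections A. diff2 A \<omega> X Y Z = (\<lambda>p. 0))"
      by (intro ball_cong refl) (simp add: fun_eq_iff \<Phi>_def dorfman_graph[OF assms XY])
    finally show ?thesis .
  qed
  note dorf = this
  have "(\<forall>s\<in>sections_of A (graph \<omega>). \<forall>t\<in>sections_of A (graph \<omega>). dorfman A s t \<in> sections_of A (graph \<omega>)) \<longleftrightarrow>
      (\<forall>X\<in>sections A. \<forall>Y\<in>sections A.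
        dorfman A (X, act (flat \<omega>) X) (Y, act (flat \<omega>) Y) \<in> sections_of A (graph \<omega>))"
    (is "?L \<longleftrightarrow> ?R")
  proof
    assume ?L
    then show ?R using sections_of_graph[OF assms] by blast
  next
    assume R: ?R
    show ?L
    proof (intro ballI)
      fix s t assume st: "s \<in> sections_of A (graph \<omega>)" "t \<in> sections_of A (graph \<omega>)"
      obtain X \<xi> Y \<eta> where eq: "s = (X, \<xi>)" "t = (Y, \<eta>)" by (metis surj_pair)
      show "dorfman A s t \<in> sections_of A (graph \<omega>)"
        using R st unfolding eq sections_of_graph[OF assms] by blast
    qed
  qed
  also have "\<dots> \<longleftrightarrow> (\<forall>X\<in>sections A. \<forall>Y\<in>sections A. \<forall>Z\<in>sections A. diff2 A \<omega> X Y Z = (\<lambda>p. 0))"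
    by (intro ball_cong refl dorf)
  finally show ?thesis
    unfolding dirac_structure_def closed_two_form_def
    using assms subbundle_graph[OF assms] maximally_isotropic_graph[OF two_form_skew_symmetric[OF assms]]
    by blast
qed

text \<open>The flow of a section of the kernel of a closed form preserves that form.\<close>

lemma closed_two_form_kernel:
  assumes "closed_two_form A \<omega>" "k \<in> sections A" "X \<in> sections A" "Y \<in> sections A"
    and "\<And>Z. eval2 \<omega> k Z = (\<lambda>p. 0)"
  shows "eval2 \<omega> (bracket A k X) Y p = anchor_deriv A k (eval2 \<omega> X Y) p + eval2 \<omega> (bracket A k Y) X p"
proof -
  have "two_form A \<omega>" using assms(1) by (simp add: closed_two_form_def)
  have "diff2 A \<omega> k X Y p = 0"
    using assms(1-4) by (simp add: closed_two_form_def)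
  moreover have "eval2 \<omega> (bracket A X Y) k p = 0"
    using eval2_skew[OF two_form_skew_symmetric[OF \<open>two_form A \<omega>\<close>], of _ k p] assms(5) by simp
  ultimately show ?thesis
    by (simp add: diff2_def assms(5) anchor_deriv_zero)
qed

text \<open>In the invariance formula for \<open>k\<close>, applied to \<open>l\<close>, both
  remaining terms contain \<open>l\<close> as an argument of \<omega> and vanish.\<close>

lemma kernel_bracket_kernel:
  assumes "closed_two_form A \<omega>" "k \<in> sections A" "l \<in> sections A" "Y \<in> sections A"
    and "\<And>Z. eval2 \<omega> k Z = (\<lambda>p. 0)" "\<And>Z. eval2 \<omega> l Z = (\<lambda>p. 0)"
  shows "eval2 \<omega> (bracket A k l) Y p = 0"
proof -
  have "two_form A \<omega>" using assms(1) by (simp add: closed_two_form_def)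
  then have "eval2 \<omega> (bracket A k Y) l p = 0"
    using eval2_skew[OF two_form_skew_symmetric, of A \<omega> _ l p] assms(6) by simp
  then show ?thesis
    using closed_two_form_kernel[OF assms(1-5)] by (simp add: assms(6) anchor_deriv_zero)
qed

text \<open>A kernel section of \<omega> is one of \<open>form_comp \<omega> N\<close> too, as
  \<open>N\<close> can be moved to the other argument. Invariance of
  \<open>form_comp \<omega> N\<close> on \<open>X\<close>, \<open>Y\<close> and of \<omega> on
  \<open>act N X\<close>, \<open>Y\<close> then have the same right-hand side.\<close>

lemma kernel_bracket_endomorphism:
  assumes "closed_two_form A \<omega>" "closed_two_form A (form_comp \<omega> N)" "endomorphism A N"
    and "k \<in> sections A" "X \<in> sections A" "Y \<in> sections A" "\<And>Z. eval2 \<omega> k Z = (\<lambda>p. 0)"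
  shows "eval2 \<omega> (bracket A k (act N X)) Y p = eval2 \<omega> (act N (bracket A k X)) Y p"
proof -
  have tf: "two_form A \<omega>" "two_form A (form_comp \<omega> N)"
    using assms(1,2) by (simp_all add: closed_two_form_def)
  have swap: "eval2 \<omega> (act N V) W q = eval2 \<omega> V (act N W) q" for V W q
    using eval2_skew[OF two_form_skew_symmetric[OF tf(2)], of V W q]
      eval2_skew[OF two_form_skew_symmetric[OF tf(1)], of "act N W" V q]
    by (simp add: eval2_form_comp)
  have "eval2 (form_comp \<omega> N) k Z = (\<lambda>p. 0)" for Z
    by (rule ext) (simp add: eval2_form_comp swap assms(7))
  from closed_two_form_kernel[OF assms(2,4-6) this, of p]
  have "eval2 \<omega> (act N (bracket A k X)) Y p =
      anchor_deriv A k (eval2 \<omega> (act N X) Y) p + eval2 \<omega> (bracket A k Y) (act N X) p"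
    by (simp add: eval2_form_comp swap)
  then show ?thesis
    using closed_two_form_kernel[OF assms(1,4) act_endomorphism[OF assms(3) open_UNIV assms(5)] assms(6,7), of p]
    by simp
qed

end

section \<open>Dirac pairs and \<open>\<Omega>N\<close>-structures\<close>

context lie_algd
begin

context
  fixes \<omega> :: "'m \<Rightarrow> 'a \<Rightarrow>\<^sub>L 'a \<Rightarrow>\<^sub>L real" and N :: "'m \<Rightarrow> 'a \<Rightarrow>\<^sub>L 'a"
  assumes two_form: "two_form A \<omega>"
    and endomorphism: "endomorphism A N"
    and skew: "skew_symmetric (form_comp \<omega> N)"
begin

lemma eval2_act_swap: "eval2 \<omega> (act N X) Y p = eval2 \<omega> X (act N Y) p"
  using eval2_skew[OF skew, of X Y p] eval2_skew[OF two_form_skew_symmetric[OF two_form], of "act N Y" X p]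
  by (simp add: eval2_form_comp)

lemma act_N_section: "X \<in> sections A \<Longrightarrow> act N X \<in> sections A"
  by (rule act_endomorphism[OF endomorphism open_UNIV])

lemma two_form_N: "two_form A (form_comp \<omega> N)"
  by (rule two_form_form_comp[OF two_form endomorphism skew])

text \<open>Pairing the defining equation of the relation with \<open>x\<close> and using skewness
  of both forms moves \<open>x\<close> into the first argument.\<close>

lemma rel_N_plus_subset_dual: "rel_N_plus A \<omega> N \<subseteq> dual_relation A (rel_N A \<omega> N)"
proof -
  have "pairing (act (flat (form_comp \<omega> N)) x) u = pairing (act (flat \<omega>) x) v"
    if "act (flat (form_comp \<omega> N)) u = act (flat \<omega>) v" for x u v
  proof -
    have "pairing (act (flat (form_comp \<omega> N)) u) x = pairing (act (flat \<omega>) v) x"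
      by (simp only: that)
    then have "eval2 (form_comp \<omega> N) u x p = eval2 \<omega> v x p" for p
      by (auto simp: pairing_act_flat fun_eq_iff)
    then have "eval2 (form_comp \<omega> N) x u p = eval2 \<omega> x v p" for p
      using eval2_skew[OF skew, of x u p] eval2_skew[OF two_form_skew_symmetric[OF two_form], of x v p]
      by simp
    then show ?thesis by (simp add: pairing_act_flat)
  qed
  then show ?thesis
    using act_flat_section[OF two_form] act_flat_section[OF two_form_N]
    by (auto simp: rel_N_plus_def dual_relation_def rel_N_def)
qed

text \<open>
  On \<open>N\<^sup>+\<close> the Nijenhuis condition pairs a single section \<open>x\<close> with a torsion-like expression: both
  \<open>\<omega>\<^sub>N x = \<omega> x'\<close> and \<open>\<omega>\<^sub>N x'\<close> are pulled back to \<open>\<omega> x\<close> through \<open>\<omega> \<circ> N = N\<^sup>* \<circ> \<omega>\<close>.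
\<close>

lemma pairing_rel_N_plus:
  assumes "act (flat (form_comp \<omega> N)) x = act (flat \<omega>) x'"
  shows "pairing (act (flat \<omega>) x) a p - pairing (act (flat (form_comp \<omega> N)) x) b p
      + pairing (act (flat (form_comp \<omega> N)) x') c p =
    - eval2 \<omega> x (\<lambda>p. a p - act N b p + act N (act N c) p) p"
proof -
  have 1: "pairing (act (flat (form_comp \<omega> N)) z) Y p = - eval2 \<omega> z (act N Y) p" for z Y
    by (simp add: pairing_act_flat eval2_form_comp eval2_act_swap)
  have "eval2 \<omega> x' (act N c) p = eval2 \<omega> x (act N (act N c)) p"
    using fun_cong[OF arg_cong[OF assms, of "\<lambda>\<alpha>. pairing \<alpha> (act N c)"], of p]
    by (simp add: 1) (simp add: pairing_act_flat)
  then show ?thesis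
    by (simp add: 1) (simp add: pairing_act_flat eval2_def blinfun.diff_right blinfun.add_right)
qed

lemma nijenhuis_relation_imp_torsion:
  assumes "nijenhuis_relation A (rel_N A \<omega> N)" "X \<in> sections A" "Y \<in> sections A"
  shows "act (flat \<omega>) (torsion A N X Y) = (\<lambda>p. 0)"
proof (rule ext, rule blinfun_eqI)
  fix p v
  obtain x where x: "x \<in> sections A" "x p = v" using ex_section_through by blast
  \<comment> \<open>This puts \<open>(Z, act N Z)\<close> into the relation, and it makes the dual
    pairs coming from \<open>x\<close> and from \<open>act N x\<close> composable.\<close>
  have comp: "act (flat (form_comp \<omega> N)) Z = act (flat \<omega>) (act N Z)" for Z
    by (simp add: act_def flat_def form_comp_def blinfun.minus_left fun_eq_iff)
  have R: "(Z, act N Z) \<in> rel_N A \<omega> N" if "Z \<in> sections A" for Z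
    using that by (simp add: rel_N_def comp act_N_section)
  have dual: "(act (flat \<omega>) Z, act (flat (form_comp \<omega> N)) Z) \<in> dual_relation A (rel_N A \<omega> N)"
    if "Z \<in> sections A" for Z
    using rel_N_plus_subset_dual that by (auto simp: rel_N_plus_def)
  let ?\<alpha> = "act (flat \<omega>) x" and ?\<beta> = "act (flat (form_comp \<omega> N)) x"
    and ?\<gamma> = "act (flat (form_comp \<omega> N)) (act N x)"
  have "(?\<beta>, ?\<gamma>) \<in> dual_relation A (rel_N A \<omega> N)"
    using dual[OF act_N_section[OF x(1)]] by (simp only: comp)
  with assms(1) R[OF assms(2)] R[OF assms(3)] dual[OF x(1)]
  have "(\<lambda>p. pairing ?\<alpha> (bracket A (act N X) (act N Y)) p
      - pairing ?\<beta> (\<lambda>q. bracket A (act N X) Y q + bracket A X (act N Y) q) p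
      + pairing ?\<gamma> (bracket A X Y) p) = (\<lambda>p. 0)"
    unfolding nijenhuis_relation_def by fast
  then have "eval2 \<omega> x (torsion A N X Y) p = 0"
    unfolding pairing_rel_N_plus[OF comp] torsion_def by (auto dest: fun_cong[of _ _ p])
  then have "eval2 \<omega> (torsion A N X Y) x p = 0"
    using eval2_skew[OF two_form_skew_symmetric[OF two_form], of "torsion A N X Y" x p] by simp
  then show "act (flat \<omega>) (torsion A N X Y) p v = blinfun_apply 0 v"
    by (simp add: act_def flat_def eval2_def x(2) blinfun.minus_left)
qed

text \<open>
  A pair \<open>(u, v)\<close> of the relation is \<open>v = N u + k\<close> with \<open>k\<close> in the kernel of \<open>\<omega>\<close>, and closedness of
  \<open>\<omega>\<close> and \<open>\<omega>\<^sub>N\<close> makes all the terms with a kernel section cancel.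
\<close>

lemma rel_N_bracket:
  assumes "closed_two_form A \<omega>" "closed_two_form A (form_comp \<omega> N)"
    and "(u, v) \<in> rel_N A \<omega> N" "(u', v') \<in> rel_N A \<omega> N" "x \<in> sections A"
  shows "eval2 \<omega> (\<lambda>p. bracket A v v' p - act N (\<lambda>q. bracket A v u' q + bracket A u v' q) p
      + act N (act N (bracket A u u')) p) x p = eval2 \<omega> (torsion A N u u') x p"
proof -
  have sec: "u \<in> sections A" "v \<in> sections A" "u' \<in> sections A" "v' \<in> sections A"
    using assms(3,4) by (auto simp: rel_N_def)
  have ker: "eval2 \<omega> (\<lambda>q. v q - act N u q) Z = (\<lambda>p. 0)" if "(u, v) \<in> rel_N A \<omega> N" for u v Z
  proof -
    have "pairing (act (flat (form_comp \<omega> N)) u) Z = pairing (act (flat \<omega>) v) Z"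
      using that by (simp add: rel_N_def)
    then have "eval2 \<omega> (act N u) Z p = eval2 \<omega> v Z p" for p
      by (auto simp: pairing_act_flat eval2_form_comp fun_eq_iff)
    then show ?thesis
      by (auto simp: eval2_def blinfun.diff_left blinfun.diff_right)
  qed
  define k where "k = (\<lambda>q. v q - act N u q)"
  define k' where "k' = (\<lambda>q. v' q - act N u' q)"
  have k: "k \<in> sections A" "\<And>Z. eval2 \<omega> k Z = (\<lambda>p. 0)"
    and k': "k' \<in> sections A" "\<And>Z. eval2 \<omega> k' Z = (\<lambda>p. 0)"
    using ker assms(3,4) sec by (simp_all add: k_def k'_def sections_diff act_N_section)
  have v: "v = (\<lambda>q. act N u q + k q)" and v': "v' = (\<lambda>q. act N u' q + k' q)"
    by (simp_all add: k_def k'_def)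
  note Nsec = act_N_section[OF sec(1)] act_N_section[OF sec(3)]
  have split: "bracket A v Z q = bracket A (act N u) Z q + bracket A k Z q" if "Z \<in> sections A" for Z q
    unfolding v bracket_add_left[OF Nsec(1) k(1) that] ..
  \<comment> \<open>The kernel section is moved to the first argument of the bracket, where the
    lemmas on kernel sections expect it; hence the minus sign.\<close>
  have split': "bracket A Z v' q = bracket A Z (act N u') q - bracket A k' Z q" if "Z \<in> sections A" for Z q
    unfolding v' bracket_add_right[OF that Nsec(2) k'(1)] using bracket_skew[OF that k'(1), of q] by simp
  have "eval2 \<omega> (bracket A k (act N u')) x p = eval2 \<omega> (act N (bracket A k u')) x p"
    by (rule kernel_bracket_endomorphism[OF assms(1,2) endomorphism k(1) sec(3) assms(5) k(2)])
  moreover have "eval2 \<omega> (bracket A k' (act N u)) x p = eval2 \<omega> (act N (bracket A k' u)) x p"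
    by (rule kernel_bracket_endomorphism[OF assms(1,2) endomorphism k'(1) sec(1) assms(5) k'(2)])
  moreover have "eval2 \<omega> (bracket A k' k) x p = 0"
    by (rule kernel_bracket_kernel[OF assms(1) k'(1) k(1) assms(5) k'(2) k(2)])
  moreover have "bracket A v v' p = bracket A (act N u) (act N u') p + bracket A k (act N u') p
      - bracket A k' (act N u) p - bracket A k' k p"
  proof -
    have "bracket A k' v p = bracket A k' (act N u) p + bracket A k' k p"
      unfolding v bracket_add_right[OF k'(1) Nsec(1) k(1)] ..
    then show ?thesis
      by (simp add: split'[OF sec(2)] split[OF Nsec(2)])
  qed
  \<comment> \<open>Brackets of \<open>k\<close> with \<open>act N u'\<close> cancel against
    \<open>N\<close> applied to those with \<open>u'\<close>, likewise for \<open>k'\<close> and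
    \<open>u\<close>; the bracket of the two kernel sections drops out by itself.\<close>
  ultimately show ?thesis
    by (simp add: torsion_def eval2_def act_def split[OF sec(3)] split'[OF sec(1)]
        blinfun.add_left blinfun.add_right blinfun.diff_left blinfun.diff_right)
qed

lemma omega_N_structure_imp_nijenhuis_relation:
  assumes "omega_N_structure A \<omega> N" "rel_N_plus A \<omega> N = dual_relation A (rel_N A \<omega> N)"
  shows "nijenhuis_relation A (rel_N A \<omega> N)"
  unfolding nijenhuis_relation_def
proof (intro conjI)
  show "rel_N A \<omega> N \<subseteq> sections A \<times> sections A"
    by (auto simp: rel_N_def)
  have closed: "closed_two_form A \<omega>" "closed_two_form A (form_comp \<omega> N)"
    using assms(1) by (simp_all add: omega_N_structure_def)
  have "(\<lambda>p. pairing \<alpha> (bracket A v v') p - pairing \<beta> (\<lambda>q. bracket A v u' q + bracket A u v' q) p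
      + pairing \<gamma> (bracket A u u') p) = (\<lambda>p. 0)"
    if uv: "(u, v) \<in> rel_N A \<omega> N" "(u', v') \<in> rel_N A \<omega> N"
      and dual: "(\<alpha>, \<beta>) \<in> rel_N_plus A \<omega> N" "(\<beta>, \<gamma>) \<in> rel_N_plus A \<omega> N"
    for u v u' v' \<alpha> \<beta> \<gamma>
  proof
    fix p
    \<comment> \<open>Here the equality of the relations is used: \<beta> has two descriptions, and
      \<open>x'\<close> is tied to \<open>x\<close> only through \<omega>, so it may differ from
      \<open>act N x\<close> by a kernel section.\<close>
    obtain x x' where x: "x \<in> sections A" "\<alpha> = act (flat \<omega>) x" "\<beta> = act (flat (form_comp \<omega> N)) x"
      "\<beta> = act (flat \<omega>) x'" "\<gamma> = act (flat (form_comp \<omega> N)) x'"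
      using dual by (auto simp: rel_N_plus_def)
    have eq: "act (flat (form_comp \<omega> N)) x = act (flat \<omega>) x'"
      using x by simp
    have "torsion A N u u' = (\<lambda>p. 0)"
      using assms(1) uv by (auto simp: omega_N_structure_def nijenhuis_tensor_def rel_N_def)
    then have "eval2 \<omega> (torsion A N u u') x p = 0"
      by (simp add: eval2_def)
    then show "pairing \<alpha> (bracket A v v') p - pairing \<beta> (\<lambda>q. bracket A v u' q + bracket A u v' q) p
        + pairing \<gamma> (bracket A u u') p = 0"
      unfolding x(2,3,5) pairing_rel_N_plus[OF eq] rel_N_bracket[OF closed uv x(1), symmetric]
      using eval2_skew[OF two_form_skew_symmetric[OF two_form], of x] by simp
  qed
  then show "\<forall>(u\<^sub>1, v\<^sub>1)\<in>rel_N A \<omega> N. \<forall>(u\<^sub>2, v\<^sub>2)\<in>rel_N A \<omega> N. \<forall>\<alpha> \<alpha>' \<alpha>''.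
      (\<alpha>, \<alpha>') \<in> dual_relation A (rel_N A \<omega> N) \<longrightarrow> (\<alpha>', \<alpha>'') \<in> dual_relation A (rel_N A \<omega> N) \<longrightarrow>
      (\<lambda>p. pairing \<alpha> (bracket A v\<^sub>1 v\<^sub>2) p
         - pairing \<alpha>' (\<lambda>q. bracket A v\<^sub>1 u\<^sub>2 q + bracket A u\<^sub>1 v\<^sub>2 q) p
         + pairing \<alpha>'' (bracket A u\<^sub>1 u\<^sub>2) p) = (\<lambda>p. 0)"
    unfolding assms(2)[symmetric] by blast
qed

end

end

theorem theorem4p8:
  fixes A :: "('m::{t2_space,second_countable_topology}, 'e::fin_dim_inner, 'a::fin_dim_inner) algebroid"
    and \<omega> :: "'m \<Rightarrow> 'a \<Rightarrow>\<^sub>L 'a \<Rightarrow>\<^sub>L real"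
    and N :: "'m \<Rightarrow> 'a \<Rightarrow>\<^sub>L 'a"
  assumes "lie_algebroid A"
    and "two_form A \<omega>"
    and "endomorphism A N"
    and "skew_symmetric (form_comp \<omega> N)"
  shows "(omega_N_structure A \<omega> N \<and> rel_N_plus A \<omega> N = dual_relation A (rel_N A \<omega> N) \<longrightarrow>
            dirac_pair A (graph \<omega>) (graph (form_comp \<omega> N))) \<and>
         (dirac_pair A (graph \<omega>) (graph (form_comp \<omega> N)) \<longrightarrow> weak_omega_N_structure A \<omega> N)"
proof -
  interpret lie_algd A by unfold_locales (rule assms(1))
  note tf_N = two_form_N[OF assms(2-4)]
  \<comment> \<open>The two Dirac conditions are exactly the closedness conditions that both kinds
    of structure contain, so only the Nijenhuis relation remains to be compared with the
    torsion.\<close>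
  have pair: "dirac_pair A (graph \<omega>) (graph (form_comp \<omega> N)) \<longleftrightarrow>
      closed_two_form A \<omega> \<and> closed_two_form A (form_comp \<omega> N) \<and> nijenhuis_relation A (rel_N A \<omega> N)"
    by (simp add: dirac_pair_def relation_of_pair_graph[OF assms(2) tf_N]
        dirac_structure_graph_iff[OF assms(2)] dirac_structure_graph_iff[OF tf_N])
  show ?thesis
    unfolding pair weak_omega_N_structure_def
    using omega_N_structure_imp_nijenhuis_relation[OF assms(2-4)]
      nijenhuis_relation_imp_torsion[OF assms(2-4)] assms(3)
    by (auto simp: omega_N_structure_def)
qed

end
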